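(* Given a tensor $\mathcal{A}\in\mathbb{R}^{I_1\times\cdots\times I_d}$. Assume that the rank-$r_k$ approximation error of its $k$th unfolding matrix $\mathbf{A}_k\in\mathbb{R}^{(I_1\cdots I_k)\times(I_{k+1}\cdots I_d)}$ from the ULV decomposition is $\varepsilon_k$, that is, $$\mathbf{A}_k=\begin{bmatrix}\mathbf{U}^{(k)}_1&\mathbf{U}^{(k)}_2\end{bmatrix}\begin{bmatrix}\mathbf{L}^{(k)}_{11}&\mathbf{O}\\ \mathbf{L}^{(k)}_{21}&\mathbf{L}^{(k)}_{22}\end{bmatrix}\begin{bmatrix}\mathbf{V}^{(k)\top}_1\\ \mathbf{V}^{(k)\top}_2\end{bmatrix}=\mathbf{U}^{(k)}_1\mathbf{L}^{(k)}_{11}\mathbf{V}^{(k)\top}_1+\mathbf{E}^{(k)},$$ where $\mathbf{L}^{(k)}_{11}\in\mathbb{R}^{r_k\times r_k}$, $\mathbf{E}^{(k)}=\mathbf{U}^{(k)}_2(\mathbf{L}^{(k)}_{21}\mathbf{V}^{(k)\top}_1+\mathbf{L}^{(k)}_{22}\mathbf{V}^{(k)\top}_2)$ and $\|\mathbf{E}^{(k)}\|_F=\varepsilon_k$ for all $k=1,\dots,d-1$. Then the approximate tensor $\widehat{\mathcal{A}}$ with TT-ranks not higher than $\{r_k\}_{k=0}^d$, computed from $\mathcal{A}$ via the TT-ULV algorithm for fixed TT-ranks in a left-to-right sweep, satisfies $$\|\mathcal{A}-\widehat{\mathcal{A}}\|_F\le\sqrt{\sum_{k=1}^{d-1}\v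arepsilon_k^2}.$$
   Context: $\|\cdot\|_F$ is the Frobenius norm (square root of the sum of squares of all entries) of a matrix or tensor. All reshapings use the reverse lexicographic (column-major, MATLAB `reshape`) ordering: a multi-index $(i_1,\dots,i_p)$ with dimensions $(J_1,\dots,J_p)$ is merged into $i_1+\sum_{k=2}^p(i_k-1)\prod_{j=1}^{k-1}J_j$. The $k$th unfolding matrix $\mathbf{A}_k\in\mathbb{R}^{(I_1\cdots I_k)\times(I_{k+1}\cdots I_d)}$ of $\mathcal{A}$ has entries $\mathcal{A}_{i_1\cdots i_d}$, with row index merging $(i_1,\dots,i_k)$ and column index merging $(i_{k+1},\dots,i_d)$. TT format: a tensor is in TT format with cores $\mathcal{G}^{(k)}\in\mathbb{R}^{r_{k-1}\times I_k\times r_k}$, $k=1,\dots,d$ ($r_0=r_d=1$), if its entries are $\sum_{\alpha_0=1}^{r_0}\cdots\sum_{\alpha_d=1}^{r_d}\mathcal{G}^{(1)}_{\alpha_0i_1\alpha_1}\cdots\mathcal{G}^{(d)}_{\alpha_{d-1}i_d\alpha_d}$; the $r_k$ are its TT-ranks. ULV decomposition of $\mathbf{A}\in\mathbb{R}^{m\times n}$ (with leading block size $r$): $\mathbf{A}=\mathbf{U}\begin{bmatrix}\mathbf{L}_{11}&\mathbf{O}_{r\times(n-r)}\\ \mathbf{L}_{21}&\mathbf{L}_{22}\end{bmatrix}\mathbf{V}^\top$, where $\mathbf{U}=[\mathbf{U}_1\ \mathbf{U}_2]\in\mathbb{R}^{m\times m}$ and $\mathbf{V}=[\mathbf{V}_1\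 \mathbf{V}_2]\in\mathbb{R}^{n\times n}$ have orthonormal columns, $\mathbf{U}_1,\mathbf{V}_1$ have $r$ columns, $\mathbf{L}_{11}\in\mathbb{R}^{r\times r}$ and $\mathbf{L}_{22}\in\mathbb{R}^{(m-r)\times(n-r)}$ are lower triangular, $\mathbf{O}$ is a zero block, and $\mathbf{L}_{21}\in\mathbb{R}^{(m-r)\times r}$ (informally described as having small entries). The truncated rank-$r$ approximation is $\mathbf{U}_1\mathbf{L}_{11}\mathbf{V}_1^\top$, with residual $\mathbf{E}=\mathbf{A}-\mathbf{U}_1\mathbf{L}_{11}\mathbf{V}_1^\top=\mathbf{U}_2(\mathbf{L}_{21}\mathbf{V}_1^\top+\mathbf{L}_{22}\mathbf{V}_2^\top)$ and error $\|\mathbf{E}\|_F$. TT-ULV algorithm (left-to-right sweep, fixed TT-ranks $r_1,\dots,r_{d-1}$, $r_0=r_d=1$, taken such that every step makes sense). Start with $\mathbf{C}=\mathrm{reshape}(\mathcal{A},[I_1,\,I_2\cdots I_d])$. For $k=1,\dots,d-1$: (i) set $\mathbf{C}:=\mathrm{reshape}(\mathbf{C},[r_{k-1}I_k,\,I_{k+1}\cdots I_d])$; (ii) compute the truncated rank-$r_k$ approximation from a ULV decomposition, $\mathbf{C}=\mathbf{U}_1\mathbf{L}_{11}\mathbf{V}_1^\top+\mathbf{E}$ with $\mathbf{L}_{11}\in\mathbb{R}^{r_k\times r_k}$ and $\mathbf{E}$ the residual; (iii) set $\mathcal{G}^{(k)}=\mathrm{reshape}(\mathbf{U}_1,[r_{k-1},I_k,r_k])$;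 (iv) set $\mathbf{C}:=\mathbf{L}_{11}\mathbf{V}_1^\top$. Finally $\mathcal{G}^{(d)}=\mathbf{C}$ (viewed as $r_{d-1}\times I_d\times 1$). The output $\widehat{\mathcal{A}}$ is the tensor in TT format with cores $\mathcal{G}^{(1)},\dots,\mathcal{G}^{(d)}$.
   Formalization: ULV decompositions are not unique and the bound fails for arbitrary choices in the sweep; it is proved for every run whose step-k truncation error is at most ε_k, and such a run is shown always to exist. *)

theory Defs
  imports Complex_Main "Jordan_Normal_Form.Matrix"
begin

text \<open>
  All indices of tensor and matrix entries start at 0. The mode sizes (dimensions) of a tensor of
  order d are a list \<open>Is\<close> of length d, so the size of mode k (k = 1, ..., d) is \<open>Is ! (k - 1)\<close>.
  A tensor with mode sizes \<open>Is\<close> is a function on index lists; only its values on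
  \<open>multi_indices Is\<close> matter.
\<close>

type_synonym tensor = "nat list \<Rightarrow> real"

definition multi_indices :: "nat list \<Rightarrow> nat list set" where
  "multi_indices Js = {is. length is = length Js \<and> (\<forall>k<length Js. is ! k < Js ! k)}"

definition tensor_norm :: "nat list \<Rightarrow> tensor \<Rightarrow> real" where
  "tensor_norm Is X = sqrt (\<Sum>is\<in>multi_indices Is. (X is)\<^sup>2)"

definition frob_norm :: "real mat \<Rightarrow> real" where
  "frob_norm M = sqrt (\<Sum>i<dim_row M. \<Sum>j<dim_col M. (M $$ (i, j))\<^sup>2)"


text \<open>Reverse lexicographic (column-major) merging of a multi-index, and its inverse.\<close>

definition merge_index :: "nat list \<Rightarrow> nat list \<Rightarrow> nat" where
  "merge_index Js is = (\<Sum>k<length Js. is ! k * (\<Prod>j<k. Js ! j))"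

definition split_index :: "nat list \<Rightarrow> nat \<Rightarrow> nat list" where
  "split_index Js l = map (\<lambda>k. l div (\<Prod>j<k. Js ! j) mod Js ! k) [0..<length Js]"

lemma merge_index_Cons: "merge_index (J # Js) (i # is) = i + J * merge_index Js is"
  unfolding merge_index_def
  by (simp add: sum.lessThan_Suc_shift prod.lessThan_Suc_shift sum_distrib_left mult_ac
      del: sum.lessThan_Suc prod.lessThan_Suc)

lemma split_index_Cons: "split_index (J # Js) l = l mod J # split_index Js (l div J)"
  unfolding split_index_def
  by (simp add: upt_conv_Cons map_Suc_upt[symmetric] prod.lessThan_Suc_shift div_mult2_eq
      del: upt_Suc prod.lessThan_Suc)

lemma multi_indices_Cons:
  "i # is \<in> multi_indices (J # Js) \<longleftrightarrow> i < J \<and> is \<in> multi_indices Js"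
  unfolding multi_indices_def by (auto simp: nth_Cons less_Suc_eq_0_disj split: nat.splits)

lemma split_merge_index:
  "is \<in> multi_indices Js \<Longrightarrow>
     merge_index Js is < prod_list Js \<and> split_index Js (merge_index Js is) = is"
proof (induction Js arbitrary: "is")
  case Nil
  then show ?case by (simp add: multi_indices_def merge_index_def split_index_def)
next
  case (Cons J Js)
  from Cons.prems obtain i "is'" where eq: "is = i # is'"
    by (cases "is") (auto simp: multi_indices_def)
  with Cons.prems have i: "i < J" and "is'": "is' \<in> multi_indices Js"
    by (auto simp: multi_indices_Cons)
  from Cons.IH[OF "is'"] have lt: "Suc (merge_index Js is') \<le> prod_list Js"
    and inv: "split_index Js (merge_index Js is') = is'" by auto
  have "i + J * merge_index Js is' < J * Suc (merge_index Js is')" using i by simp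
  also have "\<dots> \<le> J * prod_list Js" using lt by (rule mult_le_mono2)
  finally show ?case using i inv by (simp add: eq merge_index_Cons split_index_Cons)
qed

definition unfolding_mat :: "nat list \<Rightarrow> tensor \<Rightarrow> nat \<Rightarrow> real mat" where
  "unfolding_mat Is A k = mat (prod_list (take k Is)) (prod_list (drop k Is))
     (\<lambda>(a, b). A (split_index (take k Is) a @ split_index (drop k Is) b))"

lemma unfolding_mat_entry:
  assumes "is \<in> multi_indices Is" "k \<le> length Is"
  shows "unfolding_mat Is A k $$
    (merge_index (take k Is) (take k is), merge_index (drop k Is) (drop k is)) = A is"
proof -
  have "take k is \<in> multi_indices (take k Is)" "drop k is \<in> multi_indices (drop k Is)"
    using assms by (auto simp: multi_indices_def)
  from this[THEN split_merge_index] show ?thesis by (simp add: unfolding_mat_def)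
qed

definition reshape_mat :: "nat \<Rightarrow> nat \<Rightarrow> real mat \<Rightarrow> real mat" where
  "reshape_mat m n M = mat m n
     (\<lambda>(i, j). let l = i + m * j in M $$ (l mod dim_row M, l div dim_row M))"

text \<open>
  The reshaping of a matrix with p * I rows and q columns to a p x I x q array:
  the row index is the column-major merging of the first two indices.
\<close>

definition reshape_core :: "nat \<Rightarrow> real mat \<Rightarrow> nat \<Rightarrow> nat \<Rightarrow> nat \<Rightarrow> real" where
  "reshape_core p M \<alpha> i \<beta> = M $$ (\<alpha> + p * i, \<beta>)"


text \<open>
  TT format: core number k (k = 1, ..., d) is \<open>G k\<close>, of size r (k-1) x I_k x r k. The summation
  index \<open>as\<close> runs over all (alpha_0, ..., alpha_d) with alpha_k below r k.
\<close>

definition tt_tensor ::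
  "nat list \<Rightarrow> (nat \<Rightarrow> nat) \<Rightarrow> (nat \<Rightarrow> nat \<Rightarrow> nat \<Rightarrow> nat \<Rightarrow> real) \<Rightarrow> tensor" where
  "tt_tensor Is r G is =
     (\<Sum>as\<in>multi_indices (map r [0..<Suc (length Is)]).
        \<Prod>k=1..length Is. G k (as ! (k - 1)) (is ! (k - 1)) (as ! k))"

definition in_tt_format :: "nat list \<Rightarrow> (nat \<Rightarrow> nat) \<Rightarrow> tensor \<Rightarrow> bool" where
  "in_tt_format Is r X \<longleftrightarrow> r 0 = 1 \<and> r (length Is) = 1 \<and>
     (\<exists>G. \<forall>is\<in>multi_indices Is. X is = tt_tensor Is r G is)"


definition lower_triangular :: "real mat \<Rightarrow> bool" where
  "lower_triangular M \<longleftrightarrow> (\<forall>i<dim_row M. \<forall>j<dim_col M. i < j \<longrightarrow> M $$ (i, j) = 0)"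

definition append_cols :: "real mat \<Rightarrow> real mat \<Rightarrow> real mat" where
  "append_cols M N = four_block_mat M N (0\<^sub>m 0 (dim_col M)) (0\<^sub>m 0 (dim_col N))"

definition orthonormal_cols :: "real mat \<Rightarrow> bool" where
  "orthonormal_cols Q \<longleftrightarrow> Q\<^sup>T * Q = 1\<^sub>m (dim_col Q)"

record ulv =
  ulv_U1 :: "real mat"
  ulv_U2 :: "real mat"
  ulv_L11 :: "real mat"
  ulv_L21 :: "real mat"
  ulv_L22 :: "real mat"
  ulv_V1 :: "real mat"
  ulv_V2 :: "real mat"

definition is_ulv :: "real mat \<Rightarrow> nat \<Rightarrow> ulv \<Rightarrow> bool" where
  "is_ulv M r D \<longleftrightarrow>
     (let m = dim_row M; n = dim_col M;
          U = append_cols (ulv_U1 D) (ulv_U2 D);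
          V = append_cols (ulv_V1 D) (ulv_V2 D)
      in r \<le> m \<and> r \<le> n \<and>
         ulv_U1 D \<in> carrier_mat m r \<and> ulv_U2 D \<in> carrier_mat m (m - r) \<and>
         ulv_V1 D \<in> carrier_mat n r \<and> ulv_V2 D \<in> carrier_mat n (n - r) \<and>
         ulv_L11 D \<in> carrier_mat r r \<and>
         ulv_L21 D \<in> carrier_mat (m - r) r \<and>
         ulv_L22 D \<in> carrier_mat (m - r) (n - r) \<and>
         orthonormal_cols U \<and> orthonormal_cols V \<and>
         lower_triangular (ulv_L11 D) \<and> lower_triangular (ulv_L22 D) \<and>
         M = U * four_block_mat (ulv_L11 D) (0\<^sub>m r (n - r)) (ulv_L21 D) (ulv_L22 D) * V\<^sup>T)"

definition ulv_truncation :: "ulv \<Rightarrow> real mat" where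
  "ulv_truncation D = ulv_U1 D * ulv_L11 D * (ulv_V1 D)\<^sup>T"

definition ulv_residual :: "real mat \<Rightarrow> ulv \<Rightarrow> real mat" where
  "ulv_residual M D = M - ulv_truncation D"

lemma ulv_residual_eq:
  assumes "is_ulv M r D"
  shows "ulv_residual M D =
    ulv_U2 D * (ulv_L21 D * (ulv_V1 D)\<^sup>T + ulv_L22 D * (ulv_V2 D)\<^sup>T)"
proof -
  define m n U1 U2 L11 L21 L22 V1 V2 where defs: "m = dim_row M" "n = dim_col M"
    "U1 = ulv_U1 D" "U2 = ulv_U2 D" "L11 = ulv_L11 D" "L21 = ulv_L21 D" "L22 = ulv_L22 D"
    "V1 = ulv_V1 D" "V2 = ulv_V2 D"
  have U: "U1 \<in> carrier_mat m r" "U2 \<in> carrier_mat m (m - r)"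
    and V: "V1 \<in> carrier_mat n r" "V2 \<in> carrier_mat n (n - r)"
    and L: "L11 \<in> carrier_mat r r" "L21 \<in> carrier_mat (m - r) r"
      "L22 \<in> carrier_mat (m - r) (n - r)"
    and M: "M = append_cols U1 U2 * four_block_mat L11 (0\<^sub>m r (n - r)) L21 L22
      * (append_cols V1 V2)\<^sup>T"
    using assms by (auto simp: is_ulv_def Let_def defs)
  have T: "V1\<^sup>T \<in> carrier_mat r n" "V2\<^sup>T \<in> carrier_mat (n - r) n" using V by auto
  have UL: "append_cols U1 U2 * four_block_mat L11 (0\<^sub>m r (n - r)) L21 L22 =
      four_block_mat (U1 * L11 + U2 * L21) (U2 * L22) (0\<^sub>m 0 r) (0\<^sub>m 0 (n - r))"
    unfolding append_cols_def
    by (subst mult_four_block_mat[of _ m r _ "m - r" _ 0 _ _ r _ "n - r"]) (use U L in auto)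
  have VT: "(append_cols V1 V2)\<^sup>T = four_block_mat V1\<^sup>T (0\<^sub>m r 0) V2\<^sup>T (0\<^sub>m (n - r) 0)"
    unfolding append_cols_def
    by (subst transpose_four_block_mat[of _ n r _ "n - r" _ 0]) (use V in auto)
  define P where "P = (U1 * L11 + U2 * L21) * V1\<^sup>T + U2 * L22 * V2\<^sup>T"
  define Q where "Q = U1 * L11 * V1\<^sup>T"
  define E where "E = U2 * (L21 * V1\<^sup>T + L22 * V2\<^sup>T)"
  have P: "P \<in> carrier_mat m n" and Q: "Q \<in> carrier_mat m n" and E: "E \<in> carrier_mat m n"
    using U L T by (auto simp: P_def Q_def E_def)
  have "M = four_block_mat P (0\<^sub>m m 0) (0\<^sub>m 0 n) (0\<^sub>m 0 0)"
    unfolding M UL VT P_def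
    by (subst mult_four_block_mat[of _ m r _ "n - r" _ 0 _ _ n _ 0]) (use U L T in simp_all)
  also have "\<dots> = P"
    by (rule eq_matI) (use P in auto)
  also have "\<dots> = Q + E"
  proof -
    have "(U1 * L11 + U2 * L21) * V1\<^sup>T = Q + U2 * L21 * V1\<^sup>T"
      unfolding Q_def using U L T by (intro add_mult_distrib_mat[of _ m r]) simp_all
    moreover have "E = U2 * (L21 * V1\<^sup>T) + U2 * (L22 * V2\<^sup>T)"
      unfolding E_def using U L T by (intro mult_add_distrib_mat[of _ m "m - r" _ n]) simp_all
    moreover have "U2 * (L21 * V1\<^sup>T) = U2 * L21 * V1\<^sup>T"
      using U L T by (intro assoc_mult_mat[symmetric, of _ m "m - r" _ r _ n]) simp_all
    moreover have "U2 * (L22 * V2\<^sup>T) = U2 * L22 * V2\<^sup>T"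
      using U L T by (intro assoc_mult_mat[symmetric, of _ m "m - r" _ "n - r" _ n]) simp_all
    moreover have "U2 * L21 * V1\<^sup>T \<in> carrier_mat m n" "U2 * L22 * V2\<^sup>T \<in> carrier_mat m n"
      using U L T by auto
    ultimately show ?thesis
      using assoc_add_mat[OF Q] by (simp add: P_def)
  qed
  finally have eq: "M = Q + E" .
  have "ulv_residual M D = M - Q"
    by (simp add: ulv_residual_def ulv_truncation_def defs Q_def)
  also have "\<dots> = E"
    unfolding eq by (rule eq_matI) (use Q E in auto)
  finally show ?thesis by (simp add: defs E_def)
qed


text \<open>
  The left-to-right TT-ULV sweep. \<open>C k\<close> is the matrix C at the end of step k (\<open>C 0\<close> is the
  initial one), so that step k decomposes \<open>sweep_mat Is r C k\<close>. A ULV decomposition is not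
  unique, hence a run is a relation: \<open>D k\<close> is the ULV decomposition computed in step k, and \<open>G\<close>
  are the resulting cores.
\<close>

definition sweep_mat :: "nat list \<Rightarrow> (nat \<Rightarrow> nat) \<Rightarrow> (nat \<Rightarrow> real mat) \<Rightarrow> nat \<Rightarrow> real mat" where
  "sweep_mat Is r C k =
     reshape_mat (r (k - 1) * Is ! (k - 1)) (prod_list (drop k Is)) (C (k - 1))"

definition tt_ulv_run ::
  "nat list \<Rightarrow> tensor \<Rightarrow> (nat \<Rightarrow> nat) \<Rightarrow> (nat \<Rightarrow> real mat) \<Rightarrow> (nat \<Rightarrow> ulv) \<Rightarrow>
   (nat \<Rightarrow> nat \<Rightarrow> nat \<Rightarrow> nat \<Rightarrow> real) \<Rightarrow> bool" where
  "tt_ulv_run Is A r C D G \<longleftrightarrow>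
     (let d = length Is in
       C 0 = unfolding_mat Is A 1 \<and>
       (\<forall>k\<in>{1..<d}.
          is_ulv (sweep_mat Is r C k) (r k) (D k) \<and>
          G k = reshape_core (r (k - 1)) (ulv_U1 (D k)) \<and>
          C k = ulv_L11 (D k) * (ulv_V1 (D k))\<^sup>T) \<and>
       G d = reshape_core (r (d - 1)) (reshape_mat (r (d - 1) * Is ! (d - 1)) 1 (C (d - 1))))"

end

theory Submission
  imports Defs "Jordan_Normal_Form.Determinant"
begin

text \<open>
  A truncated ULV decomposition is an orthogonal projection: with orthonormal \<open>U = ulv_U1 D\<close> the
  truncation of \<open>M\<close> is \<open>U * (U\<^sup>T * M)\<close> (\<open>is_ulv_truncation_projection\<close>). Both halves of the
  theorem rest on Pythagoras for such projections (\<open>orthonormal_projection_pythagoras\<close>).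

  Error of a run. Step \<open>k\<close> replaces a matrix \<open>M\<close> by the coefficients \<open>U\<^sup>T * M\<close>, and whatever the
  later cores make of these coefficients is multiplied by \<open>U\<close> again. The residual of step \<open>k\<close> is
  orthogonal to the span of \<open>U\<close>, hence to all errors made later, and \<open>U\<close> is an isometry. So the
  squared error of the output tensor is exactly the sum of the squared residuals of the steps
  (\<open>tt_ulv_error_sq\<close>), and bounds on the residuals give the bound of the theorem.

  Existence of a run whose residuals are bounded by the \<open>\<epsilon> k\<close>. The decomposition of the unfolding
  \<open>A\<^sub>k\<close> provides a matrix of rank at most \<open>r k\<close> at distance \<open>\<epsilon> k\<close> from \<open>A\<^sub>k\<close>. The matrix which
  the sweep meets in step \<open>k\<close> arises from \<open>A\<^sub>k\<close> by multiplication from the left with a contraction,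
  namely the earlier factors \<open>U\<^sup>T\<close> acting on the merged row index; the image of the low-rank
  approximant still has rank at most \<open>r k\<close> and is at least as close
  (\<open>factor_approx_orthonormal_transpose\<close>). Finally, a ULV decomposition can be chosen to be as
  accurate as any approximation of the same rank: let the columns of \<open>U\<close> span the columns of the
  approximant and complete the decomposition by Householder triangularization
  (\<open>ulv_as_good_as_factorization\<close>).
\<close>

section \<open>Frobenius norm and orthogonal projections\<close>

lemma frob_norm_nonneg: "0 \<le> frob_norm M"
  by (simp add: frob_norm_def sum_nonneg)

text \<open>
  Written through the Gram matrix, orthogonality relations between matrices become block
  identities, so that Pythagoras below needs no manipulation of entries.
\<close>

lemma frob_norm_sq_gram: "(frob_norm M)\<^sup>2 = (\<Sum>j<dim_col M. (M\<^sup>T * M) $$ (j, j))"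
proof -
  have "(frob_norm M)\<^sup>2 = (\<Sum>i<dim_row M. \<Sum>j<dim_col M. (M $$ (i, j))\<^sup>2)"
    by (simp add: frob_norm_def sum_nonneg)
  also have "\<dots> = (\<Sum>j<dim_col M. \<Sum>i<dim_row M. (M $$ (i, j))\<^sup>2)"
    by (rule sum.swap)
  also have "\<dots> = (\<Sum>j<dim_col M. (M\<^sup>T * M) $$ (j, j))"
    by (intro sum.cong) (auto simp: scalar_prod_def power2_eq_square lessThan_atLeast0)
  finally show ?thesis .
qed

lemma frob_norm_sq_add_orthogonal:
  assumes U: "U \<in> carrier_mat m r" "U\<^sup>T * U = 1\<^sub>m r"
    and E: "E \<in> carrier_mat m n" "U\<^sup>T * E = 0\<^sub>m r n"
    and Z: "Z \<in> carrier_mat r n"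
  shows "(frob_norm (E + U * Z))\<^sup>2 = (frob_norm E)\<^sup>2 + (frob_norm Z)\<^sup>2"
proof -
  have c: "U\<^sup>T \<in> carrier_mat r m" "E\<^sup>T \<in> carrier_mat n m" "Z\<^sup>T \<in> carrier_mat n r"
    "U * Z \<in> carrier_mat m n" using U E Z by auto
  have "(U * Z)\<^sup>T * E = Z\<^sup>T * (U\<^sup>T * E)"
    using U E Z c by (simp add: transpose_mult[OF U(1) Z] assoc_mult_mat[OF c(3) c(1) E(1)])
  also have "\<dots> = 0\<^sub>m n n" using E(2) c by simp
  finally have z1: "(U * Z)\<^sup>T * E = 0\<^sub>m n n" .
  have "E\<^sup>T * (U * Z) = ((U * Z)\<^sup>T * E)\<^sup>T"
    using c E by (simp add: transpose_mult[of "(U*Z)\<^sup>T" n m E n])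
  then have z2: "E\<^sup>T * (U * Z) = 0\<^sub>m n n" by (simp add: z1)
  have "(U * Z)\<^sup>T * (U * Z) = Z\<^sup>T * (U\<^sup>T * (U * Z))"
    using U E Z c by (simp add: transpose_mult[OF U(1) Z] assoc_mult_mat[OF c(3) c(1) c(4)])
  also have "U\<^sup>T * (U * Z) = Z"
    using U Z c by (simp add: assoc_mult_mat[OF c(1) U(1) Z, symmetric])
  finally have z3: "(U * Z)\<^sup>T * (U * Z) = Z\<^sup>T * Z" .
  have "(E + U * Z)\<^sup>T * (E + U * Z) = (E\<^sup>T + (U * Z)\<^sup>T) * (E + U * Z)"
    by (simp add: transpose_add[OF E(1) c(4)])
  also have "\<dots> = E\<^sup>T * (E + U * Z) + (U * Z)\<^sup>T * (E + U * Z)"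
    by (rule add_mult_distrib_mat) (use c E in auto)
  also have "E\<^sup>T * (E + U * Z) = E\<^sup>T * E + E\<^sup>T * (U * Z)"
    by (rule mult_add_distrib_mat) (use c E in auto)
  also have "(U * Z)\<^sup>T * (E + U * Z) = (U * Z)\<^sup>T * E + (U * Z)\<^sup>T * (U * Z)"
    by (rule mult_add_distrib_mat[where nr=n and n=m and nc=n]) (use c E in auto)
  finally have "(E + U * Z)\<^sup>T * (E + U * Z) = E\<^sup>T * E + Z\<^sup>T * Z"
    using E Z c by (simp add: z1 z2 z3)
  then show ?thesis using E Z c U
    by (simp add: frob_norm_sq_gram sum.distrib del: index_mult_mat(1) add: index_mult_mat(2,3))
qed

text \<open>
  \<open>M - U * X\<close> splits into the part of \<open>M\<close> orthogonal to the columns of \<open>U\<close> and the part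
  \<open>U * (U\<^sup>T * M - X)\<close> inside their span, where \<open>U\<close> is an isometry. Three facts come from this
  identity: projecting is the best approximation with columns in the span of \<open>U\<close>,
  multiplication by \<open>U\<^sup>T\<close> is a contraction, and the error of a TT-ULV sweep accumulates as a sum
  of squares.
\<close>

lemma orthonormal_projection_pythagoras:
  assumes U: "U \<in> carrier_mat m r" "U\<^sup>T * U = 1\<^sub>m r"
    and M: "M \<in> carrier_mat m n" and X: "X \<in> carrier_mat r n"
  shows "(frob_norm (M - U * X))\<^sup>2 =
    (frob_norm (M - U * (U\<^sup>T * M)))\<^sup>2 + (frob_norm (U\<^sup>T * M - X))\<^sup>2"
proof -
  define Y where "Y = U\<^sup>T * M"
  have c: "U\<^sup>T \<in> carrier_mat r m" "Y \<in> carrier_mat r n" "U * Y \<in> carrier_mat m n" 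
    "U * X \<in> carrier_mat m n" using U M X by (auto simp: Y_def)
  have "U\<^sup>T * (M - U * Y) = Y - U\<^sup>T * (U * Y)"
    unfolding Y_def by (rule mult_minus_distrib_mat) (use U M in auto)
  also have "U\<^sup>T * (U * Y) = Y" using U c by (simp add: assoc_mult_mat[OF c(1) U(1) c(2), symmetric])
  finally have "U\<^sup>T * (M - U * Y) = 0\<^sub>m r n" using c by simp
  moreover have "M - U * X = (M - U * Y) + U * (Y - X)"
    using U M X c by (simp add: mult_minus_distrib_mat[OF U(1) c(2) X], intro eq_matI, auto)
  ultimately show ?thesis 
    using frob_norm_sq_add_orthogonal[OF U minus_carrier_mat[OF c(3)] _ minus_carrier_mat[OF X]]
    by (simp add: Y_def[symmetric])
qed

lemma orthonormal_projection_optimal: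
  assumes "U \<in> carrier_mat m r" "U\<^sup>T * U = 1\<^sub>m r"
    and "M \<in> carrier_mat m n" and "X \<in> carrier_mat r n"
  shows "frob_norm (M - U * (U\<^sup>T * M)) \<le> frob_norm (M - U * X)"
  using orthonormal_projection_pythagoras[OF assms]
  by - (rule power2_le_imp_le, auto simp: frob_norm_nonneg)

lemma orthonormal_transpose_contraction:
  assumes U: "U \<in> carrier_mat m r" "U\<^sup>T * U = 1\<^sub>m r" and M: "M \<in> carrier_mat m n"
  shows "frob_norm (U\<^sup>T * M) \<le> frob_norm M"
proof -
  have "M - U * 0\<^sub>m r n = M" "U\<^sup>T * M - 0\<^sub>m r n = U\<^sup>T * M"
    using U M by (auto simp: minus_add_uminus_mat[of _ m n] minus_add_uminus_mat[of _ r n])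
  then show ?thesis using orthonormal_projection_pythagoras[OF U M zero_carrier_mat]
    by - (rule power2_le_imp_le, auto simp: frob_norm_nonneg)
qed

section \<open>ULV truncation as an orthogonal projection\<close>

lemma col_append_cols:
  assumes "M \<in> carrier_mat m p" "N \<in> carrier_mat m q" "j < p + q"
  shows "col (append_cols M N) j = (if j < p then col M j else col N (j - p))"
  using assms by (intro eq_vecI) (auto simp: append_cols_def)

lemma is_ulv_U1_orthonormal:
  assumes "is_ulv M r D"
  shows "(ulv_U1 D)\<^sup>T * ulv_U1 D = 1\<^sub>m r" "(ulv_U1 D)\<^sup>T * ulv_U2 D = 0\<^sub>m r (dim_row M - r)"
proof -
  define m U1 U2 where d: "m = dim_row M" "U1 = ulv_U1 D" "U2 = ulv_U2 D"
  define W where "W = append_cols U1 U2"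
  have U: "U1 \<in> carrier_mat m r" "U2 \<in> carrier_mat m (m - r)" "r \<le> m"
    and o: "W\<^sup>T * W = 1\<^sub>m (dim_col W)"
    using assms by (auto simp: is_ulv_def Let_def d orthonormal_cols_def W_def)
  have dim: "dim_col W = m" "dim_row W = m" using U by (auto simp: W_def append_cols_def)
  have g: "col W i \<bullet> col W j = (if i = j then 1 else 0)" if "i < m" "j < m" for i j
    using arg_cong[OF o, of "\<lambda>X. X $$ (i, j)"] that dim by simp
  have c: "col W j = (if j < r then col U1 j else col U2 (j - r))" if "j < m" for j
    unfolding W_def using col_append_cols[OF U(1,2)] U that by simp
  show "(ulv_U1 D)\<^sup>T * ulv_U1 D = 1\<^sub>m r" unfolding d[symmetric]
  proof (intro eq_matI)
    fix i j assume "i < dim_row (1\<^sub>m r :: real mat)" "j < dim_col (1\<^sub>m r :: real mat)"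
    then show "(U1\<^sup>T * U1) $$ (i, j) = 1\<^sub>m r $$ (i, j)"
      using g[of i j] c[of i] c[of j] U by simp
  qed (use U in auto)
  show "(ulv_U1 D)\<^sup>T * ulv_U2 D = 0\<^sub>m r (dim_row M - r)" unfolding d[symmetric]
  proof (intro eq_matI)
    fix i j assume "i < dim_row (0\<^sub>m r (m - r) :: real mat)" "j < dim_col (0\<^sub>m r (m - r) :: real mat)"
    then show "(U1\<^sup>T * U2) $$ (i, j) = 0\<^sub>m r (m - r) $$ (i, j)"
      using g[of i "j + r"] c[of i] c[of "j + r"] U by simp
  qed (use U in auto)
qed

text \<open>
  The residual has its columns in the span of \<open>ulv_U2 D\<close>, which is orthogonal to \<open>ulv_U1 D\<close>.
  Hence the truncation is the orthogonal projection of \<open>M\<close> onto the span of \<open>ulv_U1 D\<close> and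
  depends on the decomposition only through \<open>ulv_U1 D\<close>.
\<close>

lemma is_ulv_truncation_projection:
  assumes "is_ulv M r D"
  shows "ulv_L11 D * (ulv_V1 D)\<^sup>T = (ulv_U1 D)\<^sup>T * M"
    and "ulv_residual M D = M - ulv_U1 D * ((ulv_U1 D)\<^sup>T * M)"
proof -
  define m n where d: "m = dim_row M" "n = dim_col M"
  define U B where UB: "U = ulv_U1 D" "B = ulv_L11 D * (ulv_V1 D)\<^sup>T"
  have M: "M \<in> carrier_mat m n" by (simp add: d)
  have U: "U \<in> carrier_mat m r" "ulv_U2 D \<in> carrier_mat m (m - r)" and B: "B \<in> carrier_mat r n"
    and L: "ulv_L11 D \<in> carrier_mat r r" "ulv_V1 D \<in> carrier_mat n r"
    and R: "ulv_L21 D * (ulv_V1 D)\<^sup>T + ulv_L22 D * (ulv_V2 D)\<^sup>T \<in> carrier_mat (m - r) n"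
    using assms by (auto simp: is_ulv_def Let_def d UB)
  have c: "U\<^sup>T \<in> carrier_mat r m" using U by simp
  have E: "ulv_residual M D = M - U * B"
    unfolding ulv_residual_def ulv_truncation_def UB
    using assoc_mult_mat[of "ulv_U1 D" m r "ulv_L11 D" r "(ulv_V1 D)\<^sup>T" n] U L UB by simp
  have "U\<^sup>T * ulv_residual M D = (U\<^sup>T * ulv_U2 D) * (ulv_L21 D * (ulv_V1 D)\<^sup>T + ulv_L22 D * (ulv_V2 D)\<^sup>T)"
    unfolding ulv_residual_eq[OF assms] using assoc_mult_mat[OF c U(2) R] by simp
  also have "\<dots> = 0\<^sub>m r n" using is_ulv_U1_orthonormal[OF assms] left_mult_zero_mat[OF R] by (simp add: UB d)
  finally have z: "U\<^sup>T * ulv_residual M D = 0\<^sub>m r n" .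
  have "U\<^sup>T * (M - U * B) = U\<^sup>T * M - U\<^sup>T * (U * B)"
    by (rule mult_minus_distrib_mat) (use U M B in auto)
  also have "U\<^sup>T * (U * B) = B" 
    using is_ulv_U1_orthonormal(1)[OF assms] B
    by (simp add: assoc_mult_mat[OF c U(1) B, symmetric] UB(1)[symmetric])
  finally have z': "U\<^sup>T * M - B = 0\<^sub>m r n" using z E by simp
  have "B = U\<^sup>T * M"
  proof (rule eq_matI)
    fix i j assume ij: "i < dim_row (U\<^sup>T * M)" "j < dim_col (U\<^sup>T * M)"
    have "(U\<^sup>T * M - B) $$ (i, j) = 0" using z' ij U M by simp
    then show "B $$ (i, j) = (U\<^sup>T * M) $$ (i, j)" using ij U M B by simp
  qed (use U M B in auto)
  then show "ulv_L11 D * (ulv_V1 D)\<^sup>T = (ulv_U1 D)\<^sup>T * M"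
    "ulv_residual M D = M - ulv_U1 D * ((ulv_U1 D)\<^sup>T * M)" using E by (auto simp: UB)
qed

section \<open>Existence of ULV decompositions\<close>

text \<open>
  The reflection at the hyperplane orthogonal to \<open>w = v - \<sigma> e\<^sub>0\<close>, where \<open>\<sigma>\<close> is the Euclidean norm
  of \<open>v\<close>, maps \<open>v\<close> to \<open>\<sigma> e\<^sub>0\<close>. If \<open>w = 0\<close> then \<open>v\<close> already has this form, and division by zero
  turns the formula for the reflection into the identity, which is what this case requires.
\<close>

lemma householder_reflection:
  fixes v :: "nat \<Rightarrow> real"
  obtains H where "H \<in> carrier_mat (Suc m) (Suc m)" "H\<^sup>T * H = 1\<^sub>m (Suc m)"
    "\<And>i. 0 < i \<Longrightarrow> i \<le> m \<Longrightarrow> (\<Sum>j\<le>m. H $$ (i, j) * v j) = 0"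
proof -
  define \<sigma> where "\<sigma> = sqrt (\<Sum>j\<le>m. (v j)\<^sup>2)"
  have \<sigma>: "\<sigma>\<^sup>2 = (\<Sum>j\<le>m. (v j)\<^sup>2)" by (simp add: \<sigma>_def sum_nonneg)
  define w where "w j = v j - (if j = 0 then \<sigma> else 0)" for j :: nat
  define s where "s = (\<Sum>j\<le>m. (w j)\<^sup>2)"
  define H where "H = mat (Suc m) (Suc m) (\<lambda>(i, j). (if i = j then 1 else 0) - 2 / s * w i * w j)"
  have wv: "(\<Sum>j\<le>m. w j * v j) = \<sigma>\<^sup>2 - \<sigma> * v 0"
  proof -
    have "(\<Sum>j\<le>m. w j * v j) = (\<Sum>j\<le>m. (v j)\<^sup>2 - (if j = 0 then \<sigma> * v 0 else 0))"
      by (intro sum.cong) (auto simp: w_def power2_eq_square algebra_simps)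
    then show ?thesis by (simp add: sum_subtractf \<sigma>)
  qed
  \<comment> \<open>This makes the factor \<open>2 / s\<close> times the inner product of \<open>w\<close> and \<open>v\<close> equal to 1,
    so that \<open>v\<close> is mapped to \<open>v - w\<close>.\<close>
  have s2: "s = 2 * (\<Sum>j\<le>m. w j * v j)"
  proof -
    have "s = (\<Sum>j\<le>m. (v j)\<^sup>2 + (if j = 0 then \<sigma>\<^sup>2 - 2 * \<sigma> * v 0 else 0))" unfolding s_def
      by (intro sum.cong) (auto simp: w_def power2_eq_square algebra_simps)
    then show ?thesis unfolding wv by (simp add: sum.distrib \<sigma>)
  qed
  have Hsum: "(\<Sum>j\<le>m. H $$ (i, j) * x j) = x i - 2 / s * w i * (\<Sum>j\<le>m. w j * x j)" if "i \<le> m" for i x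
  proof -
    have "(\<Sum>j\<le>m. H $$ (i, j) * x j) = (\<Sum>j\<le>m. (if i = j then x j else 0) - 2 / s * w i * (w j * x j))"
      by (intro sum.cong) (use that in \<open>auto simp: H_def algebra_simps\<close>)
    then show ?thesis using that by (simp add: sum_subtractf sum_distrib_left)
  qed
  have HH: "H\<^sup>T * H = 1\<^sub>m (Suc m)"
  proof (intro eq_matI)
    fix i j assume "i < dim_row (1\<^sub>m (Suc m) :: real mat)" "j < dim_col (1\<^sub>m (Suc m) :: real mat)"
    then have ij: "i \<le> m" "j \<le> m" by auto
    have "(H\<^sup>T * H) $$ (i, j) = (\<Sum>k\<le>m. H $$ (i, k) * H $$ (k, j))"
      using ij by (simp add: H_def scalar_prod_def atMost_atLeast0 atLeastLessThanSuc_atLeastAtMost del: sum.op_ivl_Suc)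
        (auto intro!: sum.cong)
    also have "\<dots> = H $$ (i, j) - 2 / s * w i * (\<Sum>k\<le>m. w k * H $$ (k, j))"
      by (rule Hsum[OF ij(1)])
    also have "(\<Sum>k\<le>m. w k * H $$ (k, j)) = (\<Sum>k\<le>m. H $$ (j, k) * w k)"
      using ij by (intro sum.cong) (auto simp: H_def)
    also have "\<dots> = w j - 2 / s * w j * s"
      unfolding Hsum[OF ij(2)] by (simp add: s_def power2_eq_square)
    also have "H $$ (i, j) - 2 / s * w i * (w j - 2 / s * w j * s) = (if i = j then 1 else 0)"
      using ij by (cases "s = 0") (auto simp: H_def field_simps)
    finally show "(H\<^sup>T * H) $$ (i, j) = 1\<^sub>m (Suc m) $$ (i, j)" using ij by simp
  qed (auto simp: H_def)
  have "(\<Sum>j\<le>m. H $$ (i, j) * v j) = 0" if "0 < i" "i \<le> m" for i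
  proof (cases "s = 0")
    case True
    then have "w i = 0" using that by (simp add: s_def sum_nonneg_eq_0_iff)
    then show ?thesis using Hsum[OF that(2), of v] that by (simp add: w_def)
  next
    case False
    then show ?thesis using Hsum[OF that(2), of v] that s2 by (simp add: w_def)
  qed
  then show thesis using HH by (intro that[of H]) (auto simp: H_def)
qed

text \<open>
  A Householder reflection clears the first row of \<open>M\<close> to the right of the diagonal; the
  induction continues with the trailing block.
\<close>

lemma lq_decomposition:
  fixes M :: "real mat"
  assumes "M \<in> carrier_mat n m"
  obtains V where "V \<in> carrier_mat m m" "V\<^sup>T * V = 1\<^sub>m m" "lower_triangular (M * V)"
proof -
  have "\<exists>V \<in> carrier_mat m m. V\<^sup>T * V = 1\<^sub>m m \<and> lower_triangular (M * V)"
    using assms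
  proof (induction m arbitrary: n M)
    case 0
    show ?case by (rule bexI[of _ "1\<^sub>m 0"]) (use 0 in \<open>auto simp: lower_triangular_def\<close>)
  next
    case (Suc m)
    show ?case
    proof (cases n)
      case 0
      show ?thesis
        by (rule bexI[of _ "1\<^sub>m (Suc m)"]) (use Suc.prems 0 in \<open>auto simp: lower_triangular_def\<close>)
    next
      case (Suc n')
      note M = Suc.prems[unfolded Suc]
      obtain H where H: "H \<in> carrier_mat (Suc m) (Suc m)" "H\<^sup>T * H = 1\<^sub>m (Suc m)"
        and Hv: "\<And>i. 0 < i \<Longrightarrow> i \<le> m \<Longrightarrow> (\<Sum>j\<le>m. H $$ (i, j) * M $$ (0, j)) = 0"
        using householder_reflection[of m "\<lambda>j. M $$ (0, j)"] by metis
      define N where "N = M * H\<^sup>T"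
      have N: "N \<in> carrier_mat (Suc n') (Suc m)" using M H by (simp add: N_def)
      have N0: "N $$ (0, i) = 0" if "0 < i" "i \<le> m" for i
        using Hv[OF that] that M H
        by (simp add: N_def scalar_prod_def atMost_atLeast0 atLeastLessThanSuc_atLeastAtMost mult.commute
            del: sum.op_ivl_Suc)
      define N' where "N' = mat n' m (\<lambda>(i, j). N $$ (Suc i, Suc j))"
      define c where "c = mat n' 1 (\<lambda>(i, j). N $$ (Suc i, 0))"
      define a where "a = mat 1 1 (\<lambda>_. N $$ (0, 0))"
      have N_eq: "N = four_block_mat a (0\<^sub>m 1 m) c N'"
      proof (intro eq_matI)
        fix i j assume "i < dim_row (four_block_mat a (0\<^sub>m 1 m) c N')" "j < dim_col (four_block_mat a (0\<^sub>m 1 m) c N')"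
        then show "N $$ (i, j) = four_block_mat a (0\<^sub>m 1 m) c N' $$ (i, j)"
          using N0[of j] by (cases i; cases j) (auto simp: a_def c_def N'_def)
      qed (use N in \<open>auto simp: a_def N'_def\<close>)
      obtain W where W: "W \<in> carrier_mat m m" "W\<^sup>T * W = 1\<^sub>m m" "lower_triangular (N' * W)"
        using Suc.IH[of N' n'] by (auto simp: N'_def)
      define W1 where "W1 = four_block_mat (1\<^sub>m 1) (0\<^sub>m 1 m) (0\<^sub>m m 1) W"
      have W1: "W1 \<in> carrier_mat (Suc m) (Suc m)" using W by (auto simp: W1_def)
      have W1T: "W1\<^sup>T = four_block_mat (1\<^sub>m 1) (0\<^sub>m 1 m) (0\<^sub>m m 1) W\<^sup>T"
        unfolding W1_def by (subst transpose_four_block_mat[of _ 1 1 _ m _ m]) (use W in auto)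
      have W1o: "W1\<^sup>T * W1 = 1\<^sub>m (Suc m)"
        unfolding W1T unfolding W1_def
        by (subst mult_four_block_mat[of _ 1 1 _ m _ m _ _ 1 _ m]) (use W in auto)
      have NW: "N * W1 = four_block_mat a (0\<^sub>m 1 m) c (N' * W)"
        unfolding W1_def N_eq
        by (subst mult_four_block_mat[of _ 1 1 _ m _ n' _ _ 1 _ m]) 
          (use W in \<open>auto simp: a_def c_def N'_def\<close>)
      have low: "lower_triangular (N * W1)"
        unfolding lower_triangular_def
      proof (intro allI impI)
        fix i j assume ij: "i < dim_row (N * W1)" "j < dim_col (N * W1)" "i < j"
        then show "(N * W1) $$ (i, j) = 0"
          using W(1,3) by (cases i; cases j) (auto simp: NW a_def c_def N'_def lower_triangular_def)
      qed
      have HT: "H\<^sup>T \<in> carrier_mat (Suc m) (Suc m)" using H by simp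
      have HT': "H * H\<^sup>T = 1\<^sub>m (Suc m)" using mat_mult_left_right_inverse[OF HT H(1) H(2)] .
      have "(H\<^sup>T * W1)\<^sup>T * (H\<^sup>T * W1) = W1\<^sup>T * (H * (H\<^sup>T * W1))"
        using H W1 by (simp add: transpose_mult[OF HT W1] assoc_mult_mat[of _ "Suc m" "Suc m" _ "Suc m" _ "Suc m"])
      also have "H * (H\<^sup>T * W1) = W1"
        using HT' W1 by (simp add: assoc_mult_mat[OF H(1) HT W1, symmetric])
      finally have "(H\<^sup>T * W1)\<^sup>T * (H\<^sup>T * W1) = 1\<^sub>m (Suc m)" using W1o by simp
      moreover have "M * (H\<^sup>T * W1) = N * W1"
        unfolding N_def using assoc_mult_mat[OF M HT W1] by simp
      ultimately show ?thesis
        using low HT W1 by (intro bexI[of _ "H\<^sup>T * W1"]) auto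
    qed
  qed
  then show thesis using that by blast
qed


text \<open>
  The truncation error depends only on the span of \<open>ulv_U1\<close>, and this span can be prescribed.
  An orthogonal \<open>U\<close> is chosen so that the span of its first \<open>r\<close> columns contains the columns of \<open>X\<close>
  (triangularize \<open>X\<close>). An LQ decomposition of \<open>U\<^sup>T * M\<close> then gives all triangular blocks at
  once, and the optimality of the projection compares the residual with \<open>M - X * Y\<close>.
\<close>

lemma ulv_as_good_as_factorization:
  assumes M: "M \<in> carrier_mat m n" and r: "r \<le> m" "r \<le> n"
    and X: "X \<in> carrier_mat m r" and Y: "Y \<in> carrier_mat r n"
  obtains D where "is_ulv M r D" "frob_norm (ulv_residual M D) \<le> frob_norm (M - X * Y)"
proof -
  obtain U where U: "U \<in> carrier_mat m m" "U\<^sup>T * U = 1\<^sub>m m" and lowX: "lower_triangular (X\<^sup>T * U)"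
    using lq_decomposition[of "X\<^sup>T" r m] X by auto
  have UT: "U\<^sup>T \<in> carrier_mat m m" using U by simp
  have UUT: "U * U\<^sup>T = 1\<^sub>m m" using mat_mult_left_right_inverse[OF UT U(1) U(2)] .
  have UTM: "U\<^sup>T * M \<in> carrier_mat m n" using U M by simp
  obtain V where V: "V \<in> carrier_mat n n" "V\<^sup>T * V = 1\<^sub>m n" and lowL: "lower_triangular (U\<^sup>T * M * V)"
    using lq_decomposition[OF UTM] by auto
  have VT: "V\<^sup>T \<in> carrier_mat n n" using V by simp
  have VVT: "V * V\<^sup>T = 1\<^sub>m n" using mat_mult_left_right_inverse[OF VT V(1) V(2)] .
  define L where "L = U\<^sup>T * M * V"
  have L: "L \<in> carrier_mat m n" using UTM V by (simp add: L_def)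
  have L0: "L $$ (i, j) = 0" if "i < m" "j < n" "i < j" for i j
    using lowL L that unfolding L_def[symmetric] lower_triangular_def by auto
  define U1 where "U1 = mat m r (\<lambda>(i, j). U $$ (i, j))"
  define D where "D = \<lparr>ulv_U1 = U1,
    ulv_U2 = mat m (m - r) (\<lambda>(i, j). U $$ (i, j + r)),
    ulv_L11 = mat r r (\<lambda>(i, j). L $$ (i, j)),
    ulv_L21 = mat (m - r) r (\<lambda>(i, j). L $$ (i + r, j)),
    ulv_L22 = mat (m - r) (n - r) (\<lambda>(i, j). L $$ (i + r, j + r)),
    ulv_V1 = mat n r (\<lambda>(i, j). V $$ (i, j)),
    ulv_V2 = mat n (n - r) (\<lambda>(i, j). V $$ (i, j + r))\<rparr>"
  have U_blocks: "append_cols (ulv_U1 D) (ulv_U2 D) = U"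
    by (rule eq_matI) (use U r in \<open>auto simp: D_def U1_def append_cols_def\<close>)
  have V_blocks: "append_cols (ulv_V1 D) (ulv_V2 D) = V"
    by (rule eq_matI) (use V r in \<open>auto simp: D_def append_cols_def\<close>)
  have L_blocks: "four_block_mat (ulv_L11 D) (0\<^sub>m r (n - r)) (ulv_L21 D) (ulv_L22 D) = L"
    by (rule eq_matI) (use L L0 r in \<open>auto simp: D_def\<close>)
  have "U * L * V\<^sup>T = U * (U\<^sup>T * M * V * V\<^sup>T)"
    unfolding L_def[symmetric] by (rule assoc_mult_mat[OF U(1) L VT])
  also have "U\<^sup>T * M * V * V\<^sup>T = U\<^sup>T * M"
    using VVT right_mult_one_mat[OF UTM] by (simp add: assoc_mult_mat[OF UTM V(1) VT])
  also have "U * (U\<^sup>T * M) = M"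
    using M UUT by (simp add: assoc_mult_mat[OF U(1) UT M, symmetric])
  finally have M_eq: "M = U * L * V\<^sup>T" by simp
  have D: "is_ulv M r D"
    unfolding is_ulv_def Let_def
    using M r U V M_eq L0 unfolding orthonormal_cols_def lower_triangular_def
    by (simp add: U_blocks V_blocks L_blocks) (auto simp: D_def U1_def)
  define R where "R = U\<^sup>T * X"
  have R: "R \<in> carrier_mat m r" using U X by (simp add: R_def)
  have R0: "R $$ (k, j) = 0" if "k < m" "j < r" "j < k" for k j
  proof -
    have "R = (X\<^sup>T * U)\<^sup>T" using U X by (simp add: R_def transpose_mult[of "X\<^sup>T" r m U m])
    then show ?thesis using lowX that U X unfolding lower_triangular_def by auto
  qed
  define R1 where "R1 = mat r r (\<lambda>(i, j). R $$ (i, j))"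
  have U1: "U1 \<in> carrier_mat m r" and R1: "R1 \<in> carrier_mat r r" by (auto simp: U1_def R1_def)
  have "X = U * R"
    unfolding R_def using X UUT by (simp add: assoc_mult_mat[OF U(1) UT X, symmetric])
  also have "\<dots> = U1 * R1"
  proof (rule eq_matI)
    fix i j assume "i < dim_row (U1 * R1)" "j < dim_col (U1 * R1)"
    then have ij: "i < m" "j < r" by (auto simp: U1_def R1_def)
    have "(U * R) $$ (i, j) = (\<Sum>k\<in>{0..<m}. U $$ (i, k) * R $$ (k, j))"
      using ij U R by (auto simp: scalar_prod_def)
    also have "\<dots> = (\<Sum>k\<in>{0..<r}. U $$ (i, k) * R $$ (k, j))"
      by (rule sum.mono_neutral_right) (use ij r R0 in auto)
    also have "\<dots> = (U1 * R1) $$ (i, j)"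
      using ij by (auto simp: scalar_prod_def U1_def R1_def)
    finally show "(U * R) $$ (i, j) = (U1 * R1) $$ (i, j)" .
  qed (use U R in \<open>auto simp: U1_def R1_def\<close>)
  finally have "X * Y = U1 * (R1 * Y)" using assoc_mult_mat[OF U1 R1 Y] by simp
  moreover have "ulv_U1 D = U1" by (simp add: D_def)
  ultimately have "frob_norm (ulv_residual M D) \<le> frob_norm (M - X * Y)"
    using orthonormal_projection_optimal[OF U1 _ M, of "R1 * Y"] is_ulv_U1_orthonormal(1)[OF D]
      is_ulv_truncation_projection(2)[OF D] R1 Y by simp
  then show thesis using that D by blast
qed

section \<open>Column-major reshaping\<close>

lemma sum_column_major:
  fixes f :: "nat \<Rightarrow> real"
  shows "(\<Sum>i<m. \<Sum>j<n. f (i + m * j)) = (\<Sum>l<m * n. f l)"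
proof -
  have "(\<Sum>i<m. \<Sum>j<n. f (i + m * j)) = (\<Sum>j<n. \<Sum>i<m. f (i + m * j))" by (rule sum.swap)
  also have "\<dots> = (\<Sum>j<n. sum f {j * m..<j * m + m})"
  proof (rule sum.cong[OF refl])
    fix j
    show "(\<Sum>i<m. f (i + m * j)) = sum f {j * m..<j * m + m}"
      using sum.shift_bounds_nat_ivl[of f 0 "j * m" m] by (simp add: lessThan_atLeast0 ac_simps)
  qed
  also have "\<dots> = (\<Sum>l<m * n. f l)" using sum.nat_group[of f m n] by (simp add: mult.commute)
  finally show ?thesis .
qed

text \<open>
  The entry at position \<open>l\<close> of the column-major enumeration, that is, of MATLAB's \<open>M(:)\<close>. A
  reshaping is characterized by leaving these values unchanged.
\<close>

definition linear_entry :: "real mat \<Rightarrow> nat \<Rightarrow> real" where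
  "linear_entry M l = M $$ (l mod dim_row M, l div dim_row M)"

lemma column_major_less:
  fixes i j m n :: nat
  assumes "i < m" "j < n" shows "i + m * j < m * n"
proof -
  have "i + m * j < m * Suc j" using assms by simp
  also have "\<dots> \<le> m * n" using assms by (intro mult_le_mono2) simp
  finally show ?thesis .
qed

lemma linear_entry_index: "i < dim_row M \<Longrightarrow> linear_entry M (i + dim_row M * j) = M $$ (i, j)"
  by (simp add: linear_entry_def)

lemma reshape_mat_carrier [simp]: "reshape_mat m n M \<in> carrier_mat m n"
  "dim_row (reshape_mat m n M) = m" "dim_col (reshape_mat m n M) = n"
  by (auto simp: reshape_mat_def)

lemma reshape_mat_index:
  "i < m \<Longrightarrow> j < n \<Longrightarrow> reshape_mat m n M $$ (i, j) = linear_entry M (i + m * j)"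
  by (simp add: reshape_mat_def linear_entry_def Let_def)

lemma linear_entry_reshape:
  assumes "l < m * n" shows "linear_entry (reshape_mat m n M) l = linear_entry M l"
proof -
  have "m > 0" using assms by (cases m) auto
  moreover have "l div m < n" using assms by (simp add: less_mult_imp_div_less mult.commute)
  ultimately show ?thesis
    unfolding linear_entry_def[of "reshape_mat m n M"] by (simp add: reshape_mat_index)
qed

lemma reshape_mat_cong:
  assumes "\<And>l. l < m * n \<Longrightarrow> linear_entry M l = linear_entry N l"
  shows "reshape_mat m n M = reshape_mat m n N"
  by (rule eq_matI) (use assms column_major_less in \<open>auto simp: reshape_mat_index\<close>)

lemma reshape_reshape_mat:
  assumes "p * q = m * n"
  shows "reshape_mat p q (reshape_mat m n M) = reshape_mat p q M"
  by (rule reshape_mat_cong) (use assms in \<open>simp add: linear_entry_reshape\<close>)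

lemma reshape_mat_id: "M \<in> carrier_mat m n \<Longrightarrow> reshape_mat m n M = M"
  by (rule eq_matI) (auto simp: reshape_mat_index linear_entry_index)

lemma reshape_mat_minus:
  assumes "M \<in> carrier_mat m n" "N \<in> carrier_mat m n" "p * q = m * n"
  shows "reshape_mat p q (M - N) = reshape_mat p q M - reshape_mat p q N"
proof (rule eq_matI)
  fix i j assume "i < dim_row (reshape_mat p q M - reshape_mat p q N)"
    "j < dim_col (reshape_mat p q M - reshape_mat p q N)"
  then have ij: "i < p" "j < q" by auto
  then have l: "i + p * j < m * n" using column_major_less[OF ij] assms by simp
  then have "m > 0" by (cases m) auto
  moreover have "(i + p * j) div m < n" using l by (simp add: less_mult_imp_div_less mult.commute)
  ultimately show "reshape_mat p q (M - N) $$ (i, j) = (reshape_mat p q M - reshape_mat p q N) $$ (i, j)"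
    using ij assms by (simp add: reshape_mat_index linear_entry_def)
qed auto

lemma frob_norm_sq_linear:
  assumes "M \<in> carrier_mat m n"
  shows "(frob_norm M)\<^sup>2 = (\<Sum>l<m * n. (linear_entry M l)\<^sup>2)"
proof -
  have "(frob_norm M)\<^sup>2 = (\<Sum>i<m. \<Sum>j<n. (M $$ (i, j))\<^sup>2)"
    using assms by (simp add: frob_norm_def sum_nonneg)
  also have "\<dots> = (\<Sum>i<m. \<Sum>j<n. (linear_entry M (i + m * j))\<^sup>2)"
    using assms linear_entry_index[of _ M] by (intro sum.cong) auto
  also have "\<dots> = (\<Sum>l<m * n. (linear_entry M l)\<^sup>2)" by (rule sum_column_major)
  finally show ?thesis .
qed

lemma frob_norm_reshape:
  assumes "M \<in> carrier_mat m n" "p * q = m * n"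
  shows "frob_norm (reshape_mat p q M) = frob_norm M"
proof (rule power2_eq_imp_eq)
  show "(frob_norm (reshape_mat p q M))\<^sup>2 = (frob_norm M)\<^sup>2"
    using frob_norm_sq_linear[OF assms(1)] frob_norm_sq_linear[of "reshape_mat p q M" p q] assms(2)
    by (simp add: linear_entry_reshape)
qed (simp_all add: frob_norm_def sum_nonneg)

section \<open>Unfoldings of a tensor\<close>

lemma multi_indices_Nil: "multi_indices [] = {[]}" by (auto simp: multi_indices_def)

lemma sum_multi_indices_Cons:
  fixes f :: "nat list \<Rightarrow> real"
  shows "(\<Sum>is\<in>multi_indices (J # Js). f is) = (\<Sum>i<J. \<Sum>is\<in>multi_indices Js. f (i # is))"
proof -
  have "(\<Sum>i<J. \<Sum>is\<in>multi_indices Js. f (i # is)) =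
    (\<Sum>(i, is)\<in>{..<J} \<times> multi_indices Js. f (i # is))" by (rule sum.cartesian_product)
  also have "\<dots> = (\<Sum>is\<in>multi_indices (J # Js). f is)"
  proof (rule sum.reindex_bij_witness[where i = "\<lambda>is. (hd is, tl is)" and j = "\<lambda>(i, is). i # is"])
    fix "is" assume "is \<in> multi_indices (J # Js)"
    moreover from this obtain i "is'" where "is = i # is'" by (cases "is") (auto simp: multi_indices_def)
    ultimately show "(case (hd is, tl is) of (i, is) \<Rightarrow> i # is) = is"
      "(hd is, tl is) \<in> {..<J} \<times> multi_indices Js" by (auto simp: multi_indices_Cons)
  qed (auto simp: multi_indices_Cons)
  finally show ?thesis ..
qed

lemma sum_multi_indices_split_index:
  fixes f :: "nat list \<Rightarrow> real"
  shows "(\<Sum>is\<in>multi_indices Js. f is) = (\<Sum>l<prod_list Js. f (split_index Js l))"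
proof (induction Js arbitrary: f)
  case Nil
  show ?case by (simp add: multi_indices_Nil split_index_def)
next
  case (Cons J Js)
  have "(\<Sum>is\<in>multi_indices (J # Js). f is) =
      (\<Sum>i<J. \<Sum>l<prod_list Js. f (split_index (J # Js) (i + J * l)))"
    unfolding sum_multi_indices_Cons Cons.IH by (intro sum.cong) (auto simp: split_index_Cons)
  also have "\<dots> = (\<Sum>l<prod_list (J # Js). f (split_index (J # Js) l))"
    using sum_column_major[of "\<lambda>l. f (split_index (J # Js) l)" J "prod_list Js"] by simp
  finally show ?case .
qed

text \<open>
  Column-major merging is associative: merging two consecutive groups of modes separately and
  then merging the two results is the same as merging all modes at once. Therefore every
  unfolding of a tensor is a reshaping of every other one.
\<close>

lemma split_index_append:
  "a < prod_list Js \<Longrightarrow>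
     split_index (Js @ Ks) (a + prod_list Js * b) = split_index Js a @ split_index Ks b"
proof (induction Js arbitrary: a)
  case Nil
  then show ?case by (simp add: split_index_def)
next
  case (Cons J Js)
  have J: "J > 0" using Cons.prems by (cases J) auto
  have "a div J < prod_list Js" using Cons.prems by (simp add: less_mult_imp_div_less mult.commute)
  moreover have "(a + J * prod_list Js * b) mod J = a mod J"
    by (simp add: mult.assoc)
  moreover have "(a + J * prod_list Js * b) div J = a div J + prod_list Js * b"
    using J by (simp add: mult.assoc)
  ultimately show ?case using Cons.IH by (simp add: split_index_Cons)
qed

lemma prod_list_take_drop: "prod_list (take k Is) * prod_list (drop k Is) = prod_list (Is :: nat list)"
  by (metis append_take_drop_id prod_list.append)

lemma linear_entry_unfolding_mat:
  assumes "l < prod_list Is"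
  shows "linear_entry (unfolding_mat Is A k) l = A (split_index Is l)"
proof -
  let ?P = "prod_list (take k Is)" and ?Q = "prod_list (drop k Is)"
  have l: "l < ?P * ?Q" using assms by (simp add: prod_list_take_drop)
  have P: "?P > 0" using l by (metis gr0I mult_0 not_less_zero)
  have "l div ?P < ?Q" using l by (simp add: less_mult_imp_div_less mult.commute)
  moreover have "split_index Is l = split_index (take k Is) (l mod ?P) @ split_index (drop k Is) (l div ?P)"
    using split_index_append[of "l mod ?P" "take k Is" "drop k Is" "l div ?P"] P by simp
  ultimately show ?thesis using P by (simp add: linear_entry_def unfolding_mat_def)
qed

lemma reshape_unfolding_mat:
  "reshape_mat (prod_list (take j Is)) (prod_list (drop j Is)) (unfolding_mat Is A k) = unfolding_mat Is A j"
proof -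
  have "reshape_mat (prod_list (take j Is)) (prod_list (drop j Is)) (unfolding_mat Is A k) =
    reshape_mat (prod_list (take j Is)) (prod_list (drop j Is)) (unfolding_mat Is A j)"
    by (rule reshape_mat_cong) (simp add: prod_list_take_drop linear_entry_unfolding_mat)
  then show ?thesis by (simp add: reshape_mat_id unfolding_mat_def)
qed

section \<open>Recursive evaluation of the TT format\<close>

text \<open>
  The partial contraction of the cores \<open>k + 1, ..., d\<close> with the left bond index \<open>\<alpha>\<close> left open.
  It satisfies a recursion over the modes that runs against the sweep.
\<close>

fun tt_tail ::
  "(nat \<Rightarrow> nat) \<Rightarrow> (nat \<Rightarrow> nat \<Rightarrow> nat \<Rightarrow> nat \<Rightarrow> real) \<Rightarrow> nat \<Rightarrow> nat list \<Rightarrow> nat \<Rightarrow> real" where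
  "tt_tail r G k [] \<alpha> = 1"
| "tt_tail r G k (i # is) \<alpha> = (\<Sum>\<beta><r (Suc k). G (Suc k) \<alpha> i \<beta> * tt_tail r G (Suc k) is \<beta>)"

lemma tt_tail_eq_sum:
  "tt_tail r G k is \<alpha> =
     (\<Sum>as\<in>multi_indices (map r [Suc k..<Suc k + length is]).
        \<Prod>j=1..length is. G (k + j) ((\<alpha> # as) ! (j - 1)) (is ! (j - 1)) ((\<alpha> # as) ! j))"
proof (induction "is" arbitrary: k \<alpha>)
  case Nil
  show ?case by (simp add: multi_indices_Nil)
next
  case (Cons i "is")
  have upt: "[Suc k..<Suc k + length (i # is)] = Suc k # [Suc (Suc k)..<Suc (Suc k) + length is]"
    by (simp add: upt_conv_Cons del: upt_Suc)
  have prod: "(\<Prod>j=1..length (i # is). G (k + j) ((\<alpha> # \<beta> # as) ! (j - 1)) ((i # is) ! (j - 1)) ((\<alpha> # \<beta> # as) ! j))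
    = G (Suc k) \<alpha> i \<beta> *
      (\<Prod>j=1..length is. G (Suc k + j) ((\<beta> # as) ! (j - 1)) (is ! (j - 1)) ((\<beta> # as) ! j))" for \<beta> as
    by (simp only: One_nat_def prod.atLeast1_atMost_eq list.size add_Suc_right add_0_right prod.lessThan_Suc_shift) simp
  show ?case
    unfolding upt list.map sum_multi_indices_Cons prod
    by (simp add: Cons.IH sum_distrib_left del: upt_Suc)
qed

lemma tt_tensor_eq_tt_tail:
  assumes "r 0 = 1" "length is = length Is"
  shows "tt_tensor Is r G is = tt_tail r G 0 is 0"
proof -
  have upt: "[0..<Suc (length Is)] = 0 # [Suc 0..<Suc (length Is)]"
    by (simp add: upt_conv_Cons del: upt_Suc)
  show ?thesis
    unfolding tt_tensor_def tt_tail_eq_sum upt list.map sum_multi_indices_Cons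
    using assms by (simp del: upt_Suc)
qed

section \<open>Existence of sweeps with small residuals\<close>

lemma reshape_merge_rows:
  assumes "M \<in> carrier_mat m (p * q)" "a < m" "c < p" "j < q"
  shows "reshape_mat (m * p) q M $$ (a + m * c, j) = M $$ (a, c + p * j)"
proof -
  have "reshape_mat (m * p) q M $$ (a + m * c, j) = linear_entry M (a + m * (c + p * j))"
    using assms column_major_less[of a m c p] by (simp add: reshape_mat_index algebra_simps)
  then show ?thesis using assms linear_entry_index[of a M] by simp
qed

lemma reshape_split_rows:
  assumes "M \<in> carrier_mat (m * p) q" "a < m" "c < p" "j < q"
  shows "reshape_mat m (p * q) M $$ (a, c + p * j) = M $$ (a + m * c, j)"
proof -
  have "reshape_mat m (p * q) M $$ (a, c + p * j) = linear_entry M (a + m * c + m * p * j)"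
    using assms column_major_less[of c p j q] by (simp add: reshape_mat_index algebra_simps)
  then show ?thesis using assms linear_entry_index[of "a + m * c" M] column_major_less[of a m c p] by simp
qed

lemma column_major_cases:
  fixes l m p :: nat
  assumes "l < m * p"
  obtains a c where "a < m" "c < p" "l = a + m * c"
proof -
  have "m > 0" using assms by (cases m) auto
  moreover have "l div m < p" using assms by (simp add: less_mult_imp_div_less mult.commute)
  ultimately show thesis using that[of "l mod m" "l div m"] by simp
qed

text \<open>
  Merge the row index of \<open>X\<close> from a pair \<open>(b, c)\<close> and apply \<open>U\<^sup>T\<close> to the \<open>b\<close> part only, that is,
  multiply by the Kronecker product of the identity and \<open>U\<^sup>T\<close>. Acting on rows, this commutes
  with multiplication by \<open>Y\<close> from the right and so preserves factorizations through \<open>s\<close>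
  columns.
\<close>

lemma reshape_transpose_mult_product:
  assumes U: "U \<in> carrier_mat m r" and X: "X \<in> carrier_mat (m * p) s" and Y: "Y \<in> carrier_mat s q"
  shows "reshape_mat (r * p) q (U\<^sup>T * reshape_mat m (p * q) (X * Y)) =
    reshape_mat (r * p) s (U\<^sup>T * reshape_mat m (p * s) X) * Y"
proof (rule eq_matI)
  let ?L = "U\<^sup>T * reshape_mat m (p * q) (X * Y)" and ?R = "U\<^sup>T * reshape_mat m (p * s) X"
  have L: "?L \<in> carrier_mat r (p * q)" and R: "?R \<in> carrier_mat r (p * s)" 
    and XY: "X * Y \<in> carrier_mat (m * p) q" using U X Y by auto
  fix l j assume "l < dim_row (reshape_mat (r * p) s ?R * Y)" "j < dim_col (reshape_mat (r * p) s ?R * Y)"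
  then have l: "l < r * p" and j: "j < q" using Y by auto
  obtain a c where ac: "a < r" "c < p" "l = a + r * c" using column_major_cases[OF l] .
  have "reshape_mat (r * p) q ?L $$ (l, j) = ?L $$ (a, c + p * j)"
    unfolding ac(3) by (rule reshape_merge_rows[OF L ac(1,2) j])
  also have "\<dots> = (\<Sum>b = 0..<m. U $$ (b, a) * reshape_mat m (p * q) (X * Y) $$ (b, c + p * j))"
    using U ac j column_major_less[of c p j q] by (simp add: scalar_prod_def)
  also have "\<dots> = (\<Sum>b = 0..<m. \<Sum>t = 0..<s. U $$ (b, a) * X $$ (b + m * c, t) * Y $$ (t, j))"
    using ac j X Y column_major_less[of _ m c p]
    by (intro sum.cong) (auto simp: reshape_split_rows[OF XY] scalar_prod_def sum_distrib_left mult.assoc)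
  also have "\<dots> = (\<Sum>t = 0..<s. \<Sum>b = 0..<m. U $$ (b, a) * X $$ (b + m * c, t) * Y $$ (t, j))"
    by (rule sum.swap)
  also have "\<dots> = (\<Sum>t = 0..<s. ?R $$ (a, c + p * t) * Y $$ (t, j))"
  proof (rule sum.cong[OF refl])
    fix t assume "t \<in> {0..<s}"
    then have t: "t < s" by simp
    have "?R $$ (a, c + p * t) = (\<Sum>b = 0..<m. U $$ (b, a) * reshape_mat m (p * s) X $$ (b, c + p * t))"
      using U ac t column_major_less[of c p t s] by (simp add: scalar_prod_def)
    also have "\<dots> = (\<Sum>b = 0..<m. U $$ (b, a) * X $$ (b + m * c, t))"
      using ac t by (intro sum.cong) (auto simp: reshape_split_rows[OF X])
    finally show "(\<Sum>b = 0..<m. U $$ (b, a) * X $$ (b + m * c, t) * Y $$ (t, j)) =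
      ?R $$ (a, c + p * t) * Y $$ (t, j)" by (simp add: sum_distrib_right)
  qed
  also have "\<dots> = (\<Sum>t = 0..<s. reshape_mat (r * p) s ?R $$ (l, t) * Y $$ (t, j))"
    unfolding ac(3) using ac by (intro sum.cong) (auto simp: reshape_merge_rows[OF R])
  also have "\<dots> = (reshape_mat (r * p) s ?R * Y) $$ (l, j)"
    using l j Y by (simp add: scalar_prod_def)
  finally show "reshape_mat (r * p) q ?L $$ (l, j) = (reshape_mat (r * p) s ?R * Y) $$ (l, j)" .
qed (use Y in auto)

text \<open>
  Distance at most \<open>e\<close> to a matrix of rank at most \<open>s\<close>, with the rank expressed by a
  factorization because that is what \<open>ulv_as_good_as_factorization\<close> consumes.
\<close>

definition factor_approx :: "real mat \<Rightarrow> nat \<Rightarrow> real \<Rightarrow> bool" where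
  "factor_approx M s e \<longleftrightarrow>
     (\<exists>X\<in>carrier_mat (dim_row M) s. \<exists>Y\<in>carrier_mat s (dim_col M). frob_norm (M - X * Y) \<le> e)"

lemma factor_approx_is_ulv:
  assumes "is_ulv M r D" shows "factor_approx M r (frob_norm (ulv_residual M D))"
  unfolding factor_approx_def is_ulv_truncation_projection(2)[OF assms]
  by (rule bexI[of _ "ulv_U1 D"], rule bexI[of _ "(ulv_U1 D)\<^sup>T * M"])
    (use assms in \<open>auto simp: is_ulv_def Let_def\<close>)

text \<open>
  Low-rank approximability of later unfoldings survives a sweep step: the step acts on them by
  the map of \<open>reshape_transpose_mult_product\<close>, which keeps the rank bound of the approximant and,
  because reshaping is an isometry and \<open>U\<^sup>T\<close> a contraction, does not increase the distance.
\<close>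

lemma factor_approx_orthonormal_transpose:
  assumes U: "U \<in> carrier_mat m r" "U\<^sup>T * U = 1\<^sub>m r" and M: "M \<in> carrier_mat m (p * q)"
    and approx: "factor_approx (reshape_mat (m * p) q M) s e"
  shows "factor_approx (reshape_mat (r * p) q (U\<^sup>T * M)) s e"
proof -
  define N where "N = reshape_mat (m * p) q M"
  obtain X Y where X: "X \<in> carrier_mat (m * p) s" and Y: "Y \<in> carrier_mat s q"
    and e: "frob_norm (N - X * Y) \<le> e"
    using approx by (auto simp: factor_approx_def N_def)
  define Z where "Z = reshape_mat m (p * q) (X * Y)"
  define X' where "X' = reshape_mat (r * p) s (U\<^sup>T * reshape_mat m (p * s) X)"
  have c: "N \<in> carrier_mat (m * p) q" "X * Y \<in> carrier_mat (m * p) q" "U\<^sup>T \<in> carrier_mat r m"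
    "Z \<in> carrier_mat m (p * q)" "U\<^sup>T * M \<in> carrier_mat r (p * q)" "U\<^sup>T * Z \<in> carrier_mat r (p * q)"
    using X Y U M by (auto simp: N_def Z_def)
  have "reshape_mat m (p * q) N = M"
    unfolding N_def using reshape_reshape_mat[of m "p * q" "m * p" q M] reshape_mat_id[OF M] by simp
  then have Z: "reshape_mat m (p * q) (N - X * Y) = M - Z"
    unfolding Z_def using reshape_mat_minus[OF c(1,2), of m "p * q"] by simp
  have "reshape_mat (r * p) q (U\<^sup>T * M) - X' * Y = reshape_mat (r * p) q (U\<^sup>T * M - U\<^sup>T * Z)"
    unfolding X'_def reshape_transpose_mult_product[OF U(1) X Y, symmetric] Z_def[symmetric]
    using reshape_mat_minus[OF c(5,6), of "r * p" q] by simp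
  then have "frob_norm (reshape_mat (r * p) q (U\<^sup>T * M) - X' * Y) = frob_norm (U\<^sup>T * M - U\<^sup>T * Z)"
    using frob_norm_reshape[OF minus_carrier_mat[OF c(6)], of "r * p" q] by simp
  also have "\<dots> = frob_norm (U\<^sup>T * (M - Z))"
    by (simp add: mult_minus_distrib_mat[OF c(3) M c(4)])
  also have "\<dots> \<le> frob_norm (M - Z)"
    by (rule orthonormal_transpose_contraction[OF U minus_carrier_mat[OF c(4)]])
  also have "\<dots> = frob_norm (N - X * Y)"
    unfolding Z[symmetric] by (rule frob_norm_reshape[OF minus_carrier_mat[OF c(2)]]) simp
  also note e
  finally show ?thesis
    unfolding factor_approx_def using Y by (intro bexI[of _ X'] bexI[of _ Y]) (auto simp: X'_def)
qed

lemma prod_list_drop_take: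
  fixes Is :: "nat list"
  assumes "k < length Is"
  shows "prod_list (drop k Is) = Is ! k * prod_list (drop (Suc k) Is)"
    and "k < j \<Longrightarrow> prod_list (drop k (take j Is)) = Is ! k * prod_list (drop (Suc k) (take j Is))"
    and "k \<le> j \<Longrightarrow> prod_list (drop k (take j Is)) * prod_list (drop j Is) = prod_list (drop k Is)"
proof -
  show "prod_list (drop k Is) = Is ! k * prod_list (drop (Suc k) Is)"
    using Cons_nth_drop_Suc[OF assms] by (metis prod_list.Cons)
  show "prod_list (drop k (take j Is)) = Is ! k * prod_list (drop (Suc k) (take j Is))" if "k < j"
    using Cons_nth_drop_Suc[of k "take j Is"] assms that by (metis length_take min_less_iff_conj nth_take prod_list.Cons)
  show "prod_list (drop k (take j Is)) * prod_list (drop j Is) = prod_list (drop k Is)" if "k \<le> j"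
    using that prod_list_take_drop[of "j - k" "drop k Is"] by (simp add: drop_take)
qed

text \<open>
  One step of the sweep together with the invariant that drives it: for each mode \<open>j\<close> still ahead,
  the current matrix, reshaped as the unfolding that separates mode \<open>j\<close> from mode \<open>j + 1\<close>, is
  within \<open>\<epsilon> j\<close> of rank \<open>r j\<close>. The instance \<open>j = k + 1\<close> supplies the decomposition of this step,
  the other ones are handed on.
\<close>

lemma tt_ulv_step_exists:
  fixes Is :: "nat list"
  assumes k: "Suc k < length Is"
    and rank: "r (Suc k) \<le> r k * Is ! k" "r (Suc k) \<le> prod_list (drop (Suc k) Is)"
    and approx: "\<And>j. k < j \<Longrightarrow> j < length Is \<Longrightarrow>
      factor_approx (reshape_mat (r k * prod_list (drop k (take j Is))) (prod_list (drop j Is)) C) (r j) (\<epsilon> j)"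
  defines "M \<equiv> reshape_mat (r k * Is ! k) (prod_list (drop (Suc k) Is)) C"
  obtains D where "is_ulv M (r (Suc k)) D" "frob_norm (ulv_residual M D) \<le> \<epsilon> (Suc k)"
    "\<And>j. Suc k < j \<Longrightarrow> j < length Is \<Longrightarrow>
      factor_approx (reshape_mat (r (Suc k) * prod_list (drop (Suc k) (take j Is))) (prod_list (drop j Is))
        (ulv_L11 D * (ulv_V1 D)\<^sup>T)) (r j) (\<epsilon> j)"
proof -
  let ?m = "r k * Is ! k" and ?n = "prod_list (drop (Suc k) Is)"
  have M: "M \<in> carrier_mat ?m ?n" by (simp add: M_def)
  have "prod_list (drop k (take (Suc k) Is)) = Is ! k"
    using k prod_list_drop_take(2)[of k Is "Suc k"] by simp
  then have "factor_approx M (r (Suc k)) (\<epsilon> (Suc k))"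
    using approx[of "Suc k"] k by (simp add: M_def)
  then obtain X Y where XY: "X \<in> carrier_mat ?m (r (Suc k))" "Y \<in> carrier_mat (r (Suc k)) ?n"
    "frob_norm (M - X * Y) \<le> \<epsilon> (Suc k)"
    using M by (auto simp: factor_approx_def)
  obtain D where D: "is_ulv M (r (Suc k)) D" "frob_norm (ulv_residual M D) \<le> frob_norm (M - X * Y)"
    using ulv_as_good_as_factorization[OF M rank XY(1,2)] .
  show thesis
  proof (rule that[OF D(1) order.trans[OF D(2) XY(3)]])
    fix j assume j: "Suc k < j" "j < length Is"
    let ?p = "prod_list (drop (Suc k) (take j Is))" and ?q = "prod_list (drop j Is)"
    have n: "?n = ?p * ?q" using prod_list_drop_take(3)[of "Suc k" Is j] k j by simp
    have U: "ulv_U1 D \<in> carrier_mat ?m (r (Suc k))" using D(1) M by (auto simp: is_ulv_def Let_def)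
    have "reshape_mat (r k * prod_list (drop k (take j Is))) ?q C = reshape_mat (?m * ?p) ?q M"
      unfolding M_def using reshape_reshape_mat[of "?m * ?p" ?q ?m ?n C] prod_list_drop_take(2)[of k Is j] k j n
      by (simp add: mult.assoc)
    then have "factor_approx (reshape_mat (?m * ?p) ?q M) (r j) (\<epsilon> j)"
      using approx[of j] j by simp
    from factor_approx_orthonormal_transpose[OF U is_ulv_U1_orthonormal(1)[OF D(1)] M[unfolded n] this]
    show "factor_approx (reshape_mat (r (Suc k) * ?p) ?q (ulv_L11 D * (ulv_V1 D)\<^sup>T)) (r j) (\<epsilon> j)"
      unfolding is_ulv_truncation_projection(1)[OF D(1)] .
  qed
qed

text \<open>
  Iterating the step from the first unfolding by dependent choice. The rank bounds ensure that
  blocks of the required sizes exist in every step.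
\<close>

lemma tt_ulv_run_exists:
  fixes Is :: "nat list" and \<epsilon> :: "nat \<Rightarrow> real"
  assumes r0: "r 0 = 1"
    and rank: "\<And>k. Suc k < length Is \<Longrightarrow> r (Suc k) \<le> r k * Is ! k"
      "\<And>k. Suc k < length Is \<Longrightarrow> r (Suc k) \<le> prod_list (drop (Suc k) Is)"
    and approx: "\<And>j. 0 < j \<Longrightarrow> j < length Is \<Longrightarrow> factor_approx (unfolding_mat Is A j) (r j) (\<epsilon> j)"
  shows "\<exists>C F G. tt_ulv_run Is A r C F G \<and>
    (\<forall>k\<in>{1..<length Is}. frob_norm (ulv_residual (sweep_mat Is r C k) (F k)) \<le> \<epsilon> k)"
proof -
  let ?d = "length Is"
  define invar where "invar k C \<longleftrightarrow> (k = 0 \<longrightarrow> C = unfolding_mat Is A 1) \<and> (\<forall>j. k < j \<longrightarrow> j < ?d \<longrightarrow>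
    factor_approx (reshape_mat (r k * prod_list (drop k (take j Is))) (prod_list (drop j Is)) C) (r j) (\<epsilon> j))"
    for k C
  define step where "step k C D C' \<longleftrightarrow> (Suc k < ?d \<longrightarrow>
    (let M = reshape_mat (r k * Is ! k) (prod_list (drop (Suc k) Is)) C in
      is_ulv M (r (Suc k)) D \<and> frob_norm (ulv_residual M D) \<le> \<epsilon> (Suc k) \<and>
      C' = ulv_L11 D * (ulv_V1 D)\<^sup>T))" for k C D C'
  have "\<exists>f. \<forall>k. invar k (fst (f k)) \<and> step k (fst (f k)) (snd (f (Suc k))) (fst (f (Suc k)))"
  proof (rule dependent_nat_choice)
    show "\<exists>x :: real mat \<times> ulv. invar 0 (fst x)"
      by (rule exI[of _ "(unfolding_mat Is A 1, undefined)"])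
        (use approx r0 in \<open>simp add: invar_def reshape_unfolding_mat\<close>)
    fix x :: "real mat \<times> ulv" and k
    assume invar: "invar k (fst x)"
    show "\<exists>y. invar (Suc k) (fst y) \<and> step k (fst x) (snd y) (fst y)"
    proof (cases "Suc k < ?d")
      case True
      obtain D where D: "is_ulv (reshape_mat (r k * Is ! k) (prod_list (drop (Suc k) Is)) (fst x)) (r (Suc k)) D"
        "frob_norm (ulv_residual (reshape_mat (r k * Is ! k) (prod_list (drop (Suc k) Is)) (fst x)) D) \<le> \<epsilon> (Suc k)"
        "\<And>j. Suc k < j \<Longrightarrow> j < ?d \<Longrightarrow>
          factor_approx (reshape_mat (r (Suc k) * prod_list (drop (Suc k) (take j Is))) (prod_list (drop j Is))
            (ulv_L11 D * (ulv_V1 D)\<^sup>T)) (r j) (\<epsilon> j)"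
        using tt_ulv_step_exists[OF True rank(1)[OF True] rank(2)[OF True], of "fst x" \<epsilon>] invar
        unfolding invar_def by blast
      then show ?thesis
        by (intro exI[of _ "(ulv_L11 D * (ulv_V1 D)\<^sup>T, D)"]) (simp add: invar_def step_def)
    next
      case False
      then show ?thesis by (auto simp: invar_def step_def)
    qed
  qed
  then obtain f where f: "\<And>k. invar k (fst (f k))"
    "\<And>k. step k (fst (f k)) (snd (f (Suc k))) (fst (f (Suc k)))" by blast
  define C where "C k = fst (f k)" for k
  define F where "F k = snd (f k)" for k
  \<comment> \<open>The cores are determined by the decompositions; at \<open>k = d\<close> the remaining matrix is the core.\<close>
  define G where "G k = (if k < ?d then reshape_core (r (k - 1)) (ulv_U1 (F k)) else
    reshape_core (r (?d - 1)) (reshape_mat (r (?d - 1) * Is ! (?d - 1)) 1 (C (?d - 1))))" for k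
  have C0: "C 0 = unfolding_mat Is A 1" using f(1)[of 0] by (simp add: invar_def C_def)
  have F: "is_ulv (sweep_mat Is r C k) (r k) (F k)" "C k = ulv_L11 (F k) * (ulv_V1 (F k))\<^sup>T"
    "frob_norm (ulv_residual (sweep_mat Is r C k) (F k)) \<le> \<epsilon> k" if k: "k \<in> {1..<?d}" for k
  proof -
    obtain k' where k': "k = Suc k'" using k by (cases k) auto
    show "is_ulv (sweep_mat Is r C k) (r k) (F k)" "C k = ulv_L11 (F k) * (ulv_V1 (F k))\<^sup>T"
      "frob_norm (ulv_residual (sweep_mat Is r C k) (F k)) \<le> \<epsilon> k"
      using f(2)[of k'] k by (auto simp: k' step_def sweep_mat_def Let_def C_def F_def)
  qed
  have "tt_ulv_run Is A r C F G"
    using C0 F(1,2) by (auto simp: tt_ulv_run_def Let_def G_def)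
  then show ?thesis using F(3) by blast
qed

section \<open>Error of a sweep\<close>

text \<open>
  The matrix with which the cores \<open>k + 1, ..., d\<close> replace \<open>C k\<close> in the output tensor.
\<close>

definition tail_mat :: "nat list \<Rightarrow> (nat \<Rightarrow> nat) \<Rightarrow> (nat \<Rightarrow> nat \<Rightarrow> nat \<Rightarrow> nat \<Rightarrow> real) \<Rightarrow> nat \<Rightarrow> real mat" where
  "tail_mat Is r G k = mat (r k) (prod_list (drop k Is))
     (\<lambda>(\<alpha>, b). tt_tail r G k (split_index (drop k Is) b) \<alpha>)"

lemma tail_mat_carrier [simp]: "tail_mat Is r G k \<in> carrier_mat (r k) (prod_list (drop k Is))"
  by (simp add: tail_mat_def)

text \<open>
  Attaching one more core on the left is, after reshaping, multiplication by the matrix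
  whose reshaping is this core.
\<close>

lemma reshape_tail_mat:
  assumes k: "k < length Is"
    and U: "U \<in> carrier_mat (r k * Is ! k) (r (Suc k))" and G: "G (Suc k) = reshape_core (r k) U"
  shows "reshape_mat (r k * Is ! k) (prod_list (drop (Suc k) Is)) (tail_mat Is r G k) =
    U * tail_mat Is r G (Suc k)"
proof (rule eq_matI)
  let ?q = "prod_list (drop (Suc k) Is)" and ?T = "tail_mat Is r G (Suc k)"
  fix l b assume "l < dim_row (U * ?T)" "b < dim_col (U * ?T)"
  then have l: "l < r k * Is ! k" and b: "b < ?q" using U by (auto simp: tail_mat_def)
  obtain \<alpha> i where i: "\<alpha> < r k" "i < Is ! k" "l = \<alpha> + r k * i" using column_major_cases[OF l] .
  note drop = Cons_nth_drop_Suc[OF k, symmetric]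
  have T: "tail_mat Is r G k \<in> carrier_mat (r k) (Is ! k * ?q)"
    using tail_mat_carrier[of Is r G k] prod_list_drop_take(1)[OF k] by simp
  have "reshape_mat (r k * Is ! k) ?q (tail_mat Is r G k) $$ (l, b) = tail_mat Is r G k $$ (\<alpha>, i + Is ! k * b)"
    unfolding i(3) by (rule reshape_merge_rows[OF T i(1,2) b])
  also have "\<dots> = tt_tail r G k (split_index (drop k Is) (i + Is ! k * b)) \<alpha>"
    using i b prod_list_drop_take(1)[OF k] column_major_less[of i "Is ! k" b ?q] by (simp add: tail_mat_def)
  also have "\<dots> = tt_tail r G k (i # split_index (drop (Suc k) Is) b) \<alpha>"
    unfolding drop split_index_Cons using i by simp
  also have "\<dots> = (\<Sum>\<beta> = 0..<r (Suc k). U $$ (l, \<beta>) * ?T $$ (\<beta>, b))"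
    using b by (simp add: G reshape_core_def tail_mat_def i(3) lessThan_atLeast0)
  also have "\<dots> = (U * ?T) $$ (l, b)"
    using l b U by (simp add: scalar_prod_def tail_mat_def)
  finally show "reshape_mat (r k * Is ! k) ?q (tail_mat Is r G k) $$ (l, b) = (U * ?T) $$ (l, b)" .
qed (use U in \<open>auto simp: tail_mat_def\<close>)

text \<open>
  Let \<open>err k\<close> be the squared distance of \<open>C k\<close> from \<open>tail_mat Is r G k\<close>. In step \<open>k + 1\<close>, with
  \<open>U = ulv_U1 (F (k + 1))\<close> and \<open>M\<close> the decomposed matrix, reshaping turns this distance into that of \<open>M\<close>
  from \<open>U * tail_mat Is r G (k + 1)\<close>. Since \<open>C (k + 1) = U\<^sup>T * M\<close>, Pythagoras splits \<open>err k\<close> into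
  the squared residual of step \<open>k + 1\<close> and \<open>err (k + 1)\<close>. The last core reproduces
  \<open>C (d - 1)\<close> exactly, and \<open>err 0\<close> is the squared error of the output tensor.
\<close>

lemma tt_ulv_error_sq:
  assumes run: "tt_ulv_run Is A r C F G" and r: "r 0 = 1" "r (length Is) = 1" and d: "length Is \<ge> 1"
  shows "(tensor_norm Is (\<lambda>is. A is - tt_tensor Is r G is))\<^sup>2 =
    (\<Sum>k = 1..<length Is. (frob_norm (ulv_residual (sweep_mat Is r C k) (F k)))\<^sup>2)"
proof -
  define d where "d = length Is"
  define N where "N k = prod_list (drop k Is)" for k
  define T where "T = tail_mat Is r G"
  define err where "err k = (frob_norm (reshape_mat (r k) (N k) (C k) - T k))\<^sup>2" for k
  define res where "res k = (frob_norm (ulv_residual (sweep_mat Is r C k) (F k)))\<^sup>2" for k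
  have T: "T k \<in> carrier_mat (r k) (N k)" for k by (simp add: T_def N_def)
  have C0: "C 0 = unfolding_mat Is A 1"
    and step: "\<And>k. Suc k < d \<Longrightarrow> is_ulv (sweep_mat Is r C (Suc k)) (r (Suc k)) (F (Suc k))"
      "\<And>k. Suc k < d \<Longrightarrow> G (Suc k) = reshape_core (r k) (ulv_U1 (F (Suc k)))"
      "\<And>k. Suc k < d \<Longrightarrow> C (Suc k) = ulv_L11 (F (Suc k)) * (ulv_V1 (F (Suc k)))\<^sup>T"
    and last: "G d = reshape_core (r (d - 1)) (reshape_mat (r (d - 1) * Is ! (d - 1)) 1 (C (d - 1)))"
    using run by (auto simp: tt_ulv_run_def Let_def d_def)
  have err_reshape: "err k = (frob_norm (reshape_mat (r k * Is ! k) (N (Suc k)) (C k)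
      - reshape_mat (r k * Is ! k) (N (Suc k)) (T k)))\<^sup>2" if "k < d" for k
  proof -
    have dim: "r k * Is ! k * N (Suc k) = r k * N k"
      using prod_list_drop_take(1)[of k Is] that by (simp add: N_def d_def)
    show ?thesis
      unfolding err_def frob_norm_reshape[OF minus_carrier_mat[OF T] dim, symmetric]
      by (simp add: reshape_mat_minus[OF reshape_mat_carrier(1) T dim] reshape_reshape_mat[OF dim])
  qed
  have err_step: "err k = res (Suc k) + err (Suc k)" if k: "Suc k < d" for k
  proof -
    let ?m = "r k * Is ! k"
    define M where "M = reshape_mat ?m (N (Suc k)) (C k)"
    define U where "U = ulv_U1 (F (Suc k))"
    have M: "M \<in> carrier_mat ?m (N (Suc k))" by (simp add: M_def)
    have ulv: "is_ulv M (r (Suc k)) (F (Suc k))"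
      using step(1)[OF k] by (simp add: sweep_mat_def M_def N_def)
    have U: "U \<in> carrier_mat ?m (r (Suc k))" "U\<^sup>T * U = 1\<^sub>m (r (Suc k))"
      using ulv M is_ulv_U1_orthonormal(1)[OF ulv] by (auto simp: is_ulv_def Let_def U_def)
    have "err k = (frob_norm (M - U * T (Suc k)))\<^sup>2"
      using err_reshape[of k] reshape_tail_mat[of k Is U r G] k U(1) step(2)[OF k]
      by (simp add: T_def M_def N_def d_def U_def)
    also have "\<dots> = (frob_norm (M - U * (U\<^sup>T * M)))\<^sup>2 + (frob_norm (U\<^sup>T * M - T (Suc k)))\<^sup>2"
      by (rule orthonormal_projection_pythagoras[OF U M T])
    also have "M - U * (U\<^sup>T * M) = ulv_residual (sweep_mat Is r C (Suc k)) (F (Suc k))"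
      using is_ulv_truncation_projection(2)[OF ulv] by (simp add: sweep_mat_def M_def N_def U_def)
    also have "U\<^sup>T * M = reshape_mat (r (Suc k)) (N (Suc k)) (C (Suc k))"
      using step(3)[OF k] is_ulv_truncation_projection(1)[OF ulv] U M
      by (simp add: U_def reshape_mat_id)
    finally show ?thesis by (simp add: res_def err_def)
  qed
  have err_sum: "err 0 = (\<Sum>k = 1..<Suc n. res k) + err n" if "n < d" for n
    using that
  proof (induction n)
    case (Suc n)
    then show ?case using err_step[of n] by simp
  qed simp
  have "err 0 = (\<Sum>k = 1..<d. res k) + err (d - 1)"
  proof -
    have "Suc (d - 1) = d" using d by (simp add: d_def)
    then show ?thesis using err_sum[of "d - 1"] by (metis lessI)
  qed
  moreover have "err (d - 1) = 0"
  proof -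
    let ?k = "d - 1"
    have k: "?k < length Is" "Suc ?k = d" using d by (auto simp: d_def)
    have N: "N d = 1" by (simp add: N_def d_def)
    define U where "U = reshape_mat (r ?k * Is ! ?k) 1 (C ?k)"
    \<comment> \<open>With the empty tail as the identity, the last core is covered by \<open>reshape_tail_mat\<close> too.\<close>
    have "T d = 1\<^sub>m 1"
      using r by (intro eq_matI) (auto simp: T_def tail_mat_def d_def split_index_def)
    moreover have "reshape_mat (r ?k * Is ! ?k) (N d) (T ?k) = U * T d"
      using reshape_tail_mat[of ?k Is U r G] k last r by (simp add: T_def N_def U_def d_def)
    ultimately have "reshape_mat (r ?k * Is ! ?k) (N d) (T ?k) = U"
      using right_mult_one_mat[of U _ 1] by (simp add: U_def)
    then show ?thesis
      using err_reshape[of ?k] k N by (simp add: d_def[symmetric] U_def frob_norm_def)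
  qed
  moreover have "(tensor_norm Is (\<lambda>is. A is - tt_tensor Is r G is))\<^sup>2 = err 0"
  proof -
    have "(tensor_norm Is (\<lambda>is. A is - tt_tensor Is r G is))\<^sup>2 =
        (\<Sum>l<prod_list Is. (A (split_index Is l) - tt_tensor Is r G (split_index Is l))\<^sup>2)"
      by (simp add: tensor_norm_def sum_nonneg sum_multi_indices_split_index)
    also have "\<dots> = (\<Sum>l<prod_list Is. ((reshape_mat (r 0) (N 0) (C 0) - T 0) $$ (0, l))\<^sup>2)"
      using r by (intro sum.cong) (auto simp: T_def N_def tail_mat_def reshape_mat_index C0
        linear_entry_unfolding_mat tt_tensor_eq_tt_tail split_index_def[of Is])
    also have "\<dots> = err 0"
      using r T[of 0] by (simp add: err_def frob_norm_def sum_nonneg N_def)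
    finally show ?thesis .
  qed
  ultimately show ?thesis by (simp add: res_def d_def)
qed

theorem theorem3p1:
  fixes Is :: "nat list" and A :: tensor and r :: "nat \<Rightarrow> nat"
    and \<epsilon> :: "nat \<Rightarrow> real" and D :: "nat \<Rightarrow> ulv" and d :: nat
  assumes d: "d = length Is" "d \<ge> 1"
    and sizes: "\<forall>k\<in>{1..d}. Is ! (k - 1) \<ge> 1"
    and ranks: "r 0 = 1" "r d = 1" "\<forall>k\<in>{1..<d}. r k \<ge> 1"
    and ranks_feasible: "\<forall>k\<in>{1..<d}. r k \<le> r (k - 1) * Is ! (k - 1)"
    and ulv_A: "\<forall>k\<in>{1..<d}. is_ulv (unfolding_mat Is A k) (r k) (D k)"
    and error_A: "\<forall>k\<in>{1..<d}. frob_norm (ulv_residual (unfolding_mat Is A k) (D k)) = \<epsilon> k"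
  shows
    "(\<exists>C F G. tt_ulv_run Is A r C F G \<and>
        (\<forall>k\<in>{1..<d}. frob_norm (ulv_residual (sweep_mat Is r C k) (F k)) \<le> \<epsilon> k)) \<and>
     (\<forall>C F G. tt_ulv_run Is A r C F G \<and>
        (\<forall>k\<in>{1..<d}. frob_norm (ulv_residual (sweep_mat Is r C k) (F k)) \<le> \<epsilon> k) \<longrightarrow>
        (\<exists>s. (\<forall>k\<le>d. s k \<le> r k) \<and> in_tt_format Is s (tt_tensor Is r G)) \<and>
        tensor_norm Is (\<lambda>is. A is - tt_tensor Is r G is) \<le> sqrt (\<Sum>k=1..<d. (\<epsilon> k)\<^sup>2))"
proof (rule conjI)
  show "\<exists>C F G. tt_ulv_run Is A r C F G \<and>
      (\<forall>k\<in>{1..<d}. frob_norm (ulv_residual (sweep_mat Is r C k) (F k)) \<le> \<epsilon> k)"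
    unfolding d(1)
  proof (rule tt_ulv_run_exists[of r Is A \<epsilon>, OF ranks(1)])
    fix k assume k: "Suc k < length Is"
    then show "r (Suc k) \<le> r k * Is ! k"
      using bspec[OF ranks_feasible, of "Suc k"] d by simp
    show "r (Suc k) \<le> prod_list (drop (Suc k) Is)"
      using bspec[OF ulv_A, of "Suc k"] k d by (simp add: is_ulv_def Let_def unfolding_mat_def)
  next
    fix j assume "0 < j" "j < length Is"
    then have "j \<in> {1..<d}" using d by simp
    then show "factor_approx (unfolding_mat Is A j) (r j) (\<epsilon> j)"
      using factor_approx_is_ulv[of "unfolding_mat Is A j" "r j" "D j"] ulv_A error_A by auto
  qed
next
  show "\<forall>C F G. tt_ulv_run Is A r C F G \<and>
        (\<forall>k\<in>{1..<d}. frob_norm (ulv_residual (sweep_mat Is r C k) (F k)) \<le> \<epsilon> k) \<longrightarrow>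
        (\<exists>s. (\<forall>k\<le>d. s k \<le> r k) \<and> in_tt_format Is s (tt_tensor Is r G)) \<and>
        tensor_norm Is (\<lambda>is. A is - tt_tensor Is r G is) \<le> sqrt (\<Sum>k=1..<d. (\<epsilon> k)\<^sup>2)"
  proof (intro allI impI conjI)
    fix C F G
    assume run: "tt_ulv_run Is A r C F G \<and>
      (\<forall>k\<in>{1..<d}. frob_norm (ulv_residual (sweep_mat Is r C k) (F k)) \<le> \<epsilon> k)"
    show "\<exists>s. (\<forall>k\<le>d. s k \<le> r k) \<and> in_tt_format Is s (tt_tensor Is r G)"
      by (rule exI[of _ r]) (use ranks d in \<open>auto simp: in_tt_format_def\<close>)
    have "(tensor_norm Is (\<lambda>is. A is - tt_tensor Is r G is))\<^sup>2 =
        (\<Sum>k = 1..<d. (frob_norm (ulv_residual (sweep_mat Is r C k) (F k)))\<^sup>2)"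
      using tt_ulv_error_sq[of Is A r C F G] run ranks d by simp
    also have "\<dots> \<le> (\<Sum>k = 1..<d. (\<epsilon> k)\<^sup>2)"
      using run by (intro sum_mono power_mono) (auto simp: frob_norm_nonneg)
    finally show "tensor_norm Is (\<lambda>is. A is - tt_tensor Is r G is) \<le> sqrt (\<Sum>k=1..<d. (\<epsilon> k)\<^sup>2)"
      by (rule real_le_rsqrt)
  qed
qed

end
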